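(* Let $X=(X_t)_{t=0,\dots,n}$ be a stationary Markov chain generated by the copula $C(u,v)=a\min(u,v)+(1-a)\max(u+v-1,0)$ and Bernoulli($p$) marginal distribution, with parameter $\boldsymbol\theta=(a,p)$ in the open set $\Theta=(0,1)\times(0,1/2)$ or $\Theta=(0,1)\times(1/2,1)$. Then there exists an estimator $\hat{\boldsymbol\theta}=(\hat a,\hat p)$ which, with probability tending to $1$ as $n\to\infty$, is a solution of the maximum likelihood equations $\sum_{i,j\in\{0,1\}}\frac{n_{ij}}{p_{ij}(\boldsymbol\theta)}\frac{\partial p_{ij}(\boldsymbol\theta)}{\partial\theta_u}=0$, $u=1,2$, which converges in probability to $\boldsymbol\theta$, and such that $\sqrt{n+1}(\hat{\boldsymbol\theta}-\boldsymbol\theta)\to N_2(\mathbf 0,\Sigma^{-1})$ in distribution, where (coordinates ordered $(a,p)$) $$\Sigma^{-1}=\begin{pmatrix}\frac{a(1-a)}{p} & a(1-p)\\ a(1-p) & \frac{p(1-p)(a+1-2p)}{1-a}\end{pmatrix}\ \text{ if } p<1/2,\qquad \Sigma^{-1}=\begin{pmatrix}\frac{a(1-a)}{1-p} & -ap\\ -ap & \frac{p(1-p)(2p-1+a)}{1-a}\end{pmatrix}\ \text{ if } p>1/2.$$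
   Context: A stationary Markov chain $(X_t)$ is generated by a copula $C$ and a marginal cdf $F$ if each $X_t$ has cdf $F$ and $P(X_t\le x,X_{t+1}\le y)=C(F(x),F(y))$ for all $x,y$; Bernoulli($p$) means $P(X_t=1)=p$. The transition probabilities $p_{ij}(\boldsymbol\theta)=P(X_{t+1}=j\mid X_t=i)$ are: for $p<1/2$, $p_{00}=\frac{ap+1-2p}{1-p}$, $p_{01}=\frac{p(1-a)}{1-p}$, $p_{10}=1-a$, $p_{11}=a$; for $p\ge1/2$, $p_{00}=a$, $p_{01}=1-a$, $p_{10}=\frac{(1-p)(1-a)}{p}$, $p_{11}=\frac{a(1-p)+2p-1}{p}$. The transition counts are $n_{ij}=\#\{t\in\{0,\dots,n-1\}:X_t=i,X_{t+1}=j\}$. *)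

theory Defs
  imports "HOL-Probability.Probability"
begin

definition copulaC :: "real \<Rightarrow> real \<Rightarrow> real \<Rightarrow> real" where
  "copulaC a u v = a * min u v + (1 - a) * max (u + v - 1) 0"

definition bern_cdf :: "real \<Rightarrow> real \<Rightarrow> real" where
  "bern_cdf p x = (if x < 0 then 0 else if x < 1 then 1 - p else 1)"

definition copula_bernoulli_chain ::
    "'w measure \<Rightarrow> (nat \<Rightarrow> 'w \<Rightarrow> nat) \<Rightarrow> real \<Rightarrow> real \<Rightarrow> bool" where
  "copula_bernoulli_chain M X a p \<longleftrightarrow>
     prob_space M \<and>
     (\<forall>t. X t \<in> measurable M (count_space UNIV)) \<and>
     (\<forall>t x. measure M {\<omega>\<in>space M. real (X t \<omega>) \<le> x} = bern_cdf p x) \<and>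
     (\<forall>t x y. measure M {\<omega>\<in>space M. real (X t \<omega>) \<le> x \<and> real (X (Suc t) \<omega>) \<le> y}
                = copulaC a (bern_cdf p x) (bern_cdf p y)) \<and>
     (\<forall>n (xs :: nat \<Rightarrow> nat).
        measure M {\<omega>\<in>space M. \<forall>t\<le>Suc n. X t \<omega> = xs t}
          * measure M {\<omega>\<in>space M. X n \<omega> = xs n}
        = measure M {\<omega>\<in>space M. \<forall>t\<le>n. X t \<omega> = xs t}
          * measure M {\<omega>\<in>space M. X n \<omega> = xs n \<and> X (Suc n) \<omega> = xs (Suc n)})"

definition trans_prob :: "real \<Rightarrow> real \<Rightarrow> nat \<Rightarrow> nat \<Rightarrow> real" where
  "trans_prob a p i j =
     (if p < 1/2 then
        (if i = 0 \<and> j = 0 then (a * p + 1 - 2 * p) / (1 - p)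
         else if i = 0 \<and> j = 1 then p * (1 - a) / (1 - p)
         else if i = 1 \<and> j = 0 then 1 - a
         else a)
      else
        (if i = 0 \<and> j = 0 then a
         else if i = 0 \<and> j = 1 then 1 - a
         else if i = 1 \<and> j = 0 then (1 - p) * (1 - a) / p
         else (a * (1 - p) + 2 * p - 1) / p))"

definition trans_count :: "nat list \<Rightarrow> nat \<Rightarrow> nat \<Rightarrow> nat" where
  "trans_count xs i j = card {t. Suc t < length xs \<and> xs ! t = i \<and> xs ! Suc t = j}"

definition likelihood_equations :: "nat list \<Rightarrow> real \<times> real \<Rightarrow> bool" where
  "likelihood_equations xs \<theta> \<longleftrightarrow>
     (\<Sum>i\<in>{0,1}. \<Sum>j\<in>{0,1}. real (trans_count xs i j) / trans_prob (fst \<theta>) (snd \<theta>) i j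
        * deriv (\<lambda>a'. trans_prob a' (snd \<theta>) i j) (fst \<theta>)) = 0 \<and>
     (\<Sum>i\<in>{0,1}. \<Sum>j\<in>{0,1}. real (trans_count xs i j) / trans_prob (fst \<theta>) (snd \<theta>) i j
        * deriv (\<lambda>p'. trans_prob (fst \<theta>) p' i j) (snd \<theta>)) = 0"

definition sample :: "(nat \<Rightarrow> 'w \<Rightarrow> nat) \<Rightarrow> nat \<Rightarrow> 'w \<Rightarrow> nat list" where
  "sample X n \<omega> = map (\<lambda>t. X t \<omega>) [0..<Suc n]"

text \<open>Bivariate centred normal law N_2(0, S), S = ((s11, s12), (s12, s22)) positive definite,
  given by its Lebesgue density on real x real.\<close>
definition normal2_density :: "real \<Rightarrow> real \<Rightarrow> real \<Rightarrow> real \<times> real \<Rightarrow> real" where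
  "normal2_density s11 s12 s22 z =
     (let d = s11 * s22 - s12 ^ 2; x = fst z; y = snd z in
      exp (- (s22 * x ^ 2 - 2 * s12 * x * y + s11 * y ^ 2) / (2 * d)) / (2 * pi * sqrt d))"

definition normal2 :: "real \<Rightarrow> real \<Rightarrow> real \<Rightarrow> (real \<times> real) measure" where
  "normal2 s11 s12 s22 = density lborel (\<lambda>z. ennreal (normal2_density s11 s12 s22 z))"

definition conv_in_distr ::
    "'w measure \<Rightarrow> (nat \<Rightarrow> 'w \<Rightarrow> real \<times> real) \<Rightarrow> (real \<times> real) measure \<Rightarrow> bool" where
  "conv_in_distr M Y N \<longleftrightarrow>
     (\<forall>f :: real \<times> real \<Rightarrow> real. continuous_on UNIV f \<and> bounded (range f) \<longrightarrow>
        (\<lambda>n. \<integral>\<omega>. f (Y n \<omega>) \<partial>M) \<longlonglongrightarrow> (\<integral>z. f z \<partial>N))"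

definition conv_in_prob ::
    "'w measure \<Rightarrow> (nat \<Rightarrow> 'w \<Rightarrow> real \<times> real) \<Rightarrow> real \<times> real \<Rightarrow> bool" where
  "conv_in_prob M Y c \<longleftrightarrow>
     (\<forall>e>0. (\<lambda>n. measure M {\<omega>\<in>space M. dist (Y n \<omega>) c > e}) \<longlonglongrightarrow> 0)"

text \<open>Entries (s11, s12, s22) of Sigma^{-1}, coordinates ordered (a,p).\<close>
definition Sigma_inv :: "real \<Rightarrow> real \<Rightarrow> real \<times> real \<times> real" where
  "Sigma_inv a p =
     (if p < 1/2 then (a * (1 - a) / p, a * (1 - p), p * (1 - p) * (a + 1 - 2 * p) / (1 - a))
      else (a * (1 - a) / (1 - p), - a * p, p * (1 - p) * (2 * p - 1 + a) / (1 - a)))"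

end

theory Submission
  imports Defs "HOL-Real_Asymp.Real_Asymp"
begin

text \<open>The state process is a two-state Markov chain with \<open>\<alpha> = p\<^sub>0\<^sub>1\<close>, \<open>\<beta> = p\<^sub>1\<^sub>1\<close>, and \<open>(a, p)\<close>
  is a reparametrisation of \<open>(\<alpha>, \<beta>)\<close>, so the likelihood equations are solved by the empirical ratios
  \<open>n\<^sub>0\<^sub>1 / n\<^sub>0\<close> and \<open>n\<^sub>1\<^sub>1 / n\<^sub>1\<close>, \<open>p\<close> being estimated by the corresponding stationary probability of 1.
  The deviations \<open>n\<^sub>0\<^sub>1 - \<alpha> n\<^sub>0\<close> and \<open>n\<^sub>1\<^sub>1 - \<beta> n\<^sub>1\<close> are martingales with second moment at most n. Since
  entries into and exits from a state almost balance, this gives the law of large numbers for the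
  numbers of visits. For the joint central limit theorem, the exponential of a linear combination of
  the two deviations, multiplied by a real exponential in the numbers of visits that compensates its
  conditional variance, is a martingale up to a vanishing error; by the law of large numbers the
  compensator is asymptotically constant. Characteristic functions together with tightness then
  yield convergence in distribution, and the error of the estimator is linear in the two deviations
  up to a factor that converges in probability.\<close>

text \<open>The conditional variance of a deviation increment depends on the current state, so the
  variance accumulated up to time n is random and the one-step characteristic functions do not
  multiply out to a number; the compensator removes this dependence. With frequencies divided by
  sqrt n it stays below a constant independent of n, since the visits add up to n. Hence convergence
  in probability of the visit frequencies becomes convergence in mean, and the compensator may be
  replaced by its limit under the expectation. Each step leaves an error of third order in the
  frequency, and n errors of order n^(-3/2) vanish. Tightness comes from the second moments, so no
  inversion of characteristic functions is involved: on a large ball a test function is close to a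
  trigonometric polynomial. The two halves of the parameter space come from the sign of 1 - 2p in
  C(1-p, 1-p). On one half a is \<beta>, on the other 1 - \<alpha>, while p is the stationary
  probability of 1 on both. The limit theorems are therefore proved for general \<alpha>, \<beta>
  and for a combination c\<alpha> + d\<beta>, specialised only at the end.\<close>

section \<open>Weak convergence from characteristic functions\<close>

text \<open>The complex coefficient \<open>c\<close> carries a phase, so a single rule covers cosine
  and sine waves; expectations of such functions are controlled by characteristic functions
  alone.\<close>

inductive trig_poly :: "('a::real_inner \<Rightarrow> real) \<Rightarrow> bool" where
  wave: "trig_poly (\<lambda>z. Re (c * cis (w \<bullet> z)))"
| add: "trig_poly f \<Longrightarrow> trig_poly g \<Longrightarrow> trig_poly (\<lambda>z. f z + g z)"

lemma trig_poly_const: "trig_poly (\<lambda>z. c)"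
  using trig_poly.wave[of "complex_of_real c" 0] by simp

text \<open>Product-to-sum formula: Re z Re z' is half of Re (z z') + Re (z cnj z'), with
  frequencies \<open>w + v\<close> and \<open>w - v\<close>. It makes the trigonometric polynomials
  an algebra.\<close>

lemma trig_poly_mult:
  assumes "trig_poly f" "trig_poly g"
  shows "trig_poly (\<lambda>z. f z * g z)"
  using assms
proof (induction f)
  case (wave c w)
  from wave show ?case
  proof (induction g)
    case (wave d v)
    have "Re (c * cis (w \<bullet> z)) * Re (d * cis (v \<bullet> z)) =
       Re (c * d / 2 * cis ((w + v) \<bullet> z)) + Re (c * cnj d / 2 * cis ((w - v) \<bullet> z))" for z
      by (simp add: inner_add_left inner_diff_left cos_add sin_add cos_diff sin_diff field_simps)
    then show ?case
      using trig_poly.add[OF trig_poly.wave[of "c * d / 2" "w + v"]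
          trig_poly.wave[of "c * cnj d / 2" "w - v"]] by simp
  next
    case (add f g)
    then show ?case by (simp add: distrib_left trig_poly.add)
  qed
next
  case (add f1 f2)
  then show ?case by (simp add: distrib_right trig_poly.add)
qed

lemma trig_poly_continuous: "trig_poly f \<Longrightarrow> continuous_on S f"
proof (induction f rule: trig_poly.induct)
  case (wave c w)
  show ?case by (intro continuous_intros)
next
  case (add f g)
  then show ?case by (intro continuous_on_add)
qed

lemma trig_poly_bounded: "trig_poly f \<Longrightarrow> \<exists>B. \<forall>z. \<bar>f z\<bar> \<le> B"
proof (induction f rule: trig_poly.induct)
  case (wave c w)
  have "\<bar>Re (c * cis (w \<bullet> z))\<bar> \<le> norm c" for z
    using abs_Re_le_cmod[of "c * cis (w \<bullet> z)"] by (simp add: norm_mult)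
  then show ?case by blast
next
  case (add f g)
  then obtain A B where AB: "\<And>z. \<bar>f z\<bar> \<le> A" "\<And>z. \<bar>g z\<bar> \<le> B" by blast
  have "\<bar>f z + g z\<bar> \<le> A + B" for z
    using AB[of z] by linarith
  then show ?case by blast
qed

lemma trig_poly_polynomial_compose:
  fixes g :: "real \<Rightarrow> real"
  assumes "real_polynomial_function g" "trig_poly f"
  shows "trig_poly (\<lambda>z. g (f z))"
  using assms
proof (induction g rule: real_polynomial_function.induct)
  case (linear h)
  have "h x = h 1 * x" for x
    using linear_scale[OF bounded_linear.linear[OF linear(1)], of x 1] by simp
  then have "(\<lambda>z. h (f z)) = (\<lambda>z. h 1 * f z)" by (intro ext)
  then show ?case
    using trig_poly_mult[OF trig_poly_const[of "h 1"] \<open>trig_poly f\<close>] by argo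
next
  case (const c)
  show ?case by (rule trig_poly_const)
next
  case (add g h)
  then show ?case by (intro trig_poly.add)
next
  case (mult g h)
  then show ?case by (intro trig_poly_mult)
qed

lemma trig_poly_separates:
  fixes x y :: "'a::real_inner"
  assumes "x \<noteq> y"
  shows "\<exists>f. trig_poly f \<and> f x \<noteq> f y"
proof -
  \<comment> \<open>The frequency points along \<open>x - y\<close> and is scaled so that the two
    phases differ by exactly pi; cosine and sine then both change sign, and one of them is
    nonzero.\<close>
  define w where "w = (pi / (norm (x - y))\<^sup>2) *\<^sub>R (x - y)"
  have "w \<bullet> x - w \<bullet> y = pi"
    using assms unfolding inner_diff_right[symmetric]
    by (simp add: w_def power2_norm_eq_inner)
  then have "w \<bullet> x = w \<bullet> y + pi" by simp
  then have c: "cos (w \<bullet> x) = - cos (w \<bullet> y)" "sin (w \<bullet> x) = - sin (w \<bullet> y)" by simp_all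
  show ?thesis
  proof (cases "cos (w \<bullet> y) = 0")
    case True
    then have "sin (w \<bullet> y) \<noteq> 0" using sin_zero_abs_cos_one by fastforce
    \<comment> \<open>The coefficient -i turns the real part of the wave into a sine.\<close>
    then have "Re (-\<i> * cis (w \<bullet> x)) \<noteq> Re (-\<i> * cis (w \<bullet> y))" using c by simp
    then show ?thesis using trig_poly.wave[of "-\<i>" w] by blast
  next
    case False
    then have "Re (1 * cis (w \<bullet> x)) \<noteq> Re (1 * cis (w \<bullet> y))" using c by simp
    then show ?thesis using trig_poly.wave[of 1 w] by blast
  qed
qed

text \<open>The approximant has to stay bounded off the compact set as well. This is achieved by clipping a
  Stone-Weierstrass approximant, with a polynomial in place of the clipping function.\<close>
lemma trig_poly_approximation:
  fixes f :: "'a::euclidean_space \<Rightarrow> real"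
  assumes "compact S" "continuous_on S f" "\<And>z. z \<in> S \<Longrightarrow> \<bar>f z\<bar> \<le> B" "e > 0" "0 \<le> B"
  shows "\<exists>g. trig_poly g \<and> (\<forall>z. \<bar>g z\<bar> \<le> B + e) \<and> (\<forall>z\<in>S. \<bar>f z - g z\<bar> < e)"
proof -
  interpret function_ring_on "Collect trig_poly" S
  proof unfold_locales
    show "compact S" by fact
  qed (use trig_poly_separates in \<open>simp_all add: trig_poly_continuous trig_poly.add trig_poly_mult trig_poly_const\<close>)
  obtain h where h: "trig_poly h" "\<forall>z\<in>S. \<bar>f z - h z\<bar> < e / 2"
    using Stone_Weierstrass_basic[OF assms(2), of "e / 2"] assms(4) by auto
  \<comment> \<open>A trigonometric polynomial is bounded on the whole space, so a polynomial close
    to \<open>clip\<close> on \<open>{-A..A}\<close> controls the composition everywhere, not only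
    on \<open>S\<close>.\<close>
  obtain A where A: "\<And>z. \<bar>h z\<bar> \<le> A" using trig_poly_bounded[OF h(1)] by blast
  define clip where "clip = (\<lambda>t. max (-B) (min B t))"
  obtain g where g: "real_polynomial_function g" "\<And>t. t \<in> {-A..A} \<Longrightarrow> \<bar>clip t - g t\<bar> < e / 2"
  proof (rule Stone_Weierstrass_real_polynomial_function[of "{-A..A}" clip "e / 2"])
    show "continuous_on {-A..A} clip" unfolding clip_def by (intro continuous_intros)
  qed (use assms in auto)
  have hA: "h z \<in> {-A..A}" for z using A[of z] by (simp add: abs_le_iff)
  have "\<bar>g (h z)\<bar> \<le> B + e" for z
  proof -
    have "\<bar>clip (h z)\<bar> \<le> B" using assms(5) by (auto simp: clip_def)
    with g(2)[OF hA[of z]] assms(4) show ?thesis by linarith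
  qed
  moreover have "\<bar>f z - g (h z)\<bar> < e" if "z \<in> S" for z
  proof -
    \<comment> \<open>\<open>clip\<close> is 1-Lipschitz and fixes \<open>f z\<close>, because
      \<open>f\<close> is bounded by \<open>B\<close> on \<open>S\<close>.\<close>
    have "\<bar>f z - clip (h z)\<bar> \<le> \<bar>f z - h z\<bar>"
      using assms(3)[OF that] by (auto simp: clip_def)
    moreover have "\<bar>f z - h z\<bar> < e / 2" using h(2) that by blast
    ultimately show ?thesis using g(2)[OF hA[of z]] by linarith
  qed
  ultimately show ?thesis
    using trig_poly_polynomial_compose[OF g(1) h(1)] by blast
qed

text \<open>Linearity extends the hypothesis from single waves to their sums. Integrability under
  \<open>N\<close> is carried through the induction because additivity of the limit integral needs
  it.\<close>

lemma trig_poly_expectation_tendsto: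
  fixes P :: "nat \<Rightarrow> 'b pmf" and Y :: "nat \<Rightarrow> 'b \<Rightarrow> 'a::euclidean_space"
  assumes "prob_space N" and [measurable_cong]: "sets N = sets borel"
    and cf: "\<And>w. (\<lambda>n. measure_pmf.expectation (P n) (\<lambda>x. cis (w \<bullet> Y n x)))
               \<longlonglongrightarrow> (\<integral>z. cis (w \<bullet> z) \<partial>N)"
    and "trig_poly g"
  shows "integrable N g \<and>
    (\<lambda>n. measure_pmf.expectation (P n) (\<lambda>x. g (Y n x))) \<longlonglongrightarrow> (\<integral>z. g z \<partial>N)"
  using assms(4)
proof (induction g rule: trig_poly.induct)
  case (wave c w)
  interpret N: prob_space N by fact
  have [measurable]: "(\<lambda>z. cis (w \<bullet> z)) \<in> borel_measurable borel"
    by (intro borel_measurable_continuous_onI continuous_intros)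
  have iN: "integrable N (\<lambda>z. cis (w \<bullet> z))"
    by (intro N.integrable_const_bound[where B=1]) auto
  have iP: "integrable (P n) (\<lambda>x. cis (w \<bullet> Y n x))" for n
    by (intro measure_pmf.integrable_const_bound[where B=1]) auto
  have "(\<lambda>n. Re (c * measure_pmf.expectation (P n) (\<lambda>x. cis (w \<bullet> Y n x))))
          \<longlonglongrightarrow> Re (c * (\<integral>z. cis (w \<bullet> z) \<partial>N))"
    by (intro tendsto_intros cf)
  moreover have "Re (c * measure_pmf.expectation (P n) (\<lambda>x. cis (w \<bullet> Y n x)))
      = measure_pmf.expectation (P n) (\<lambda>x. Re (c * cis (w \<bullet> Y n x)))" for n
    using iP[of n] by (subst integral_Re) (auto intro!: integrable_mult_right)
  moreover have "Re (c * (\<integral>z. cis (w \<bullet> z) \<partial>N)) = (\<integral>z. Re (c * cis (w \<bullet> z)) \<partial>N)"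
    using iN by (subst integral_Re) (auto intro!: integrable_mult_right)
  moreover have "integrable N (\<lambda>z. Re (c * cis (w \<bullet> z)))"
    by (intro integrable_Re integrable_mult_right iN)
  ultimately show ?case by simp
next
  case (add f g)
  have iP: "integrable (P n) (\<lambda>x. h (Y n x))" if "trig_poly h" for h n
  proof -
    obtain B where "\<And>z. \<bar>h z\<bar> \<le> B" using trig_poly_bounded[OF \<open>trig_poly h\<close>] by blast
    then show ?thesis by (intro measure_pmf.integrable_const_bound[where B=B]) auto
  qed
  show ?case
    using add iP[OF add(1)] iP[OF add(2)] by (auto intro!: tendsto_add)
qed

text \<open>Tightness confines the laws to a ball up to mass e. There the test function is replaced
  by a trigonometric polynomial whose global bound keeps the contribution of the complement of order
  e.\<close>

theorem weak_convergence_from_characteristic_function: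
  fixes P :: "nat \<Rightarrow> 'b pmf" and Y :: "nat \<Rightarrow> 'b \<Rightarrow> 'a::euclidean_space"
    and f :: "'a \<Rightarrow> real"
  assumes N: "prob_space N" and [measurable_cong]: "sets N = sets borel"
    and tight: "\<And>e. e > 0 \<Longrightarrow>
      \<exists>K. \<forall>\<^sub>F n in sequentially. measure_pmf.prob (P n) {x. norm (Y n x) > K} < e"
    and cf: "\<And>w. (\<lambda>n. measure_pmf.expectation (P n) (\<lambda>x. cis (w \<bullet> Y n x)))
               \<longlonglongrightarrow> (\<integral>z. cis (w \<bullet> z) \<partial>N)"
    and f: "continuous_on UNIV f" "bounded (range f)"
  shows "(\<lambda>n. measure_pmf.expectation (P n) (\<lambda>x. f (Y n x))) \<longlonglongrightarrow> (\<integral>z. f z \<partial>N)"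
proof (rule LIMSEQ_I)
  fix r :: real assume "r > 0"
  interpret N: prob_space N by fact
  from f(2) obtain B where B0: "B > 0" and B: "\<And>z. \<bar>f z\<bar> \<le> B"
    unfolding bounded_pos by auto
  \<comment> \<open>The bound \<open>e \<le> 1\<close> gives |f - g| <= 2B + 1 off the ball. The two
    replacement errors and the limit error add up to at most (4B + 5) e, which the factor
    \<open>4 * B + 10\<close> covers with room to spare.\<close>
  define e where "e = min 1 (r / (4 * B + 10))"
  have e: "e > 0" "e \<le> 1"
    using B0 \<open>r > 0\<close> by (auto simp: e_def)
  have "e \<le> r / (4 * B + 10)" by (simp add: e_def)
  then have e': "e * (4 * B + 10) \<le> r" using B0 by (simp add: pos_le_divide_eq)
  obtain K1 where K1: "\<forall>\<^sub>F n in sequentially. measure_pmf.prob (P n) {x. norm (Y n x) > K1} < e"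
    using tight[OF e(1)] by blast
  have [measurable]: "f \<in> borel_measurable borel"
    using f(1) by (rule borel_measurable_continuous_onI)
  \<comment> \<open>Continuity from above along the complements of growing balls: the single law
    \<open>N\<close> is tight as well, so one radius serves both \<open>N\<close> and the
    sequence.\<close>
  have "(\<lambda>k. measure N {z. norm z > real k}) \<longlonglongrightarrow> measure N (\<Inter>k. {z. norm z > real k})"
    using sets_eq_imp_space_eq[OF assms(2)]
    by (intro N.finite_Lim_measure_decseq) (auto simp: decseq_def)
  moreover have "(\<Inter>k. {z::'a. norm z > real k}) = {}"
  proof -
    have "\<not> (\<forall>k. norm z > real k)" for z :: 'a
      using reals_Archimedean2[of "norm z"] less_asym by blast
    then show ?thesis by blast
  qed
  ultimately have "\<forall>\<^sub>F k in sequentially. measure N {z. norm z > real k} < e"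
    using order_tendstoD(2)[of _ 0 sequentially e] e by simp
  then obtain K2 where K2: "measure N {z. norm z > real K2} < e"
    by (auto simp: eventually_sequentially)
  define K where "K = max K1 (real K2)"
  have "measure N {z. norm z > K} \<le> measure N {z. norm z > real K2}"
    using sets_eq_imp_space_eq[OF assms(2)]
    by (intro N.finite_measure_mono) (auto simp: K_def)
  with K2 have K2': "measure N {z. norm z > K} < e" by simp
  have "measure_pmf.prob (P n) {x. norm (Y n x) > K} \<le> measure_pmf.prob (P n) {x. norm (Y n x) > K1}" for n
    by (intro measure_pmf.finite_measure_mono) (auto simp: K_def)
  with K1 have K1': "\<forall>\<^sub>F n in sequentially. measure_pmf.prob (P n) {x. norm (Y n x) > K} < e"
    by (auto elim!: eventually_mono intro: le_less_trans)
  obtain g where g: "trig_poly g" "\<And>z. \<bar>g z\<bar> \<le> B + e" "\<And>z. norm z \<le> K \<Longrightarrow> \<bar>f z - g z\<bar> < e"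
    using trig_poly_approximation[OF compact_cball continuous_on_subset[OF f(1) subset_UNIV] B e(1),
        of 0 K] B0 by auto
  have [measurable]: "g \<in> borel_measurable borel"
    using trig_poly_continuous[OF g(1)] by (rule borel_measurable_continuous_onI)
  have pointwise: "\<bar>f z - g z\<bar> \<le> e + (2 * B + 1) * indicator {z. norm z > K} z" for z
    using g(2)[of z] g(3)[of z] B[of z] e by (auto simp: indicator_def)
  have g_lim: "(\<lambda>n. measure_pmf.expectation (P n) (\<lambda>x. g (Y n x))) \<longlonglongrightarrow> (\<integral>z. g z \<partial>N)"
    using trig_poly_expectation_tendsto[OF N assms(2) cf g(1)] by simp
  have sp: "space N = UNIV" using sets_eq_imp_space_eq[OF assms(2)] by simp
  have iNf: "integrable N f" using B by (intro N.integrable_const_bound[where B=B]) auto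
  have iNg: "integrable N g" using g by (intro N.integrable_const_bound[where B="B + e"]) auto
  have iNi: "integrable N (\<lambda>z. e + (2 * B + 1) * indicator {z. norm z > K} z)"
    using B0 e by (intro N.integrable_const_bound[where B="e + (2 * B + 1)"])
      (auto simp: indicator_def)
  have "\<bar>(\<integral>z. f z \<partial>N) - (\<integral>z. g z \<partial>N)\<bar> = \<bar>\<integral>z. f z - g z \<partial>N\<bar>"
    using iNf iNg by simp
  also have "\<dots> \<le> (\<integral>z. e + (2 * B + 1) * indicator {z. norm z > K} z \<partial>N)"
    using iNf iNg iNi pointwise
    by (intro integral_abs_bound[THEN order_trans] integral_mono) simp_all
  also have "\<dots> = e + (2 * B + 1) * measure N {z. norm z > K}"
  proof -
    have "integrable N (indicat_real {z. norm z > K})"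
      by (intro N.integrable_const_bound[where B=1]) (auto simp: indicator_def)
    then show ?thesis using sp N.prob_space by simp
  qed
  also have "\<dots> < e + (2 * B + 1) * e"
    using K2' B0 by simp
  finally have dN: "\<bar>(\<integral>z. f z \<partial>N) - (\<integral>z. g z \<partial>N)\<bar> < e + (2 * B + 1) * e" .
  have dP: "\<bar>measure_pmf.expectation (P n) (\<lambda>x. f (Y n x)) - measure_pmf.expectation (P n) (\<lambda>x. g (Y n x))\<bar>
      < e + (2 * B + 1) * e" if "measure_pmf.prob (P n) {x. norm (Y n x) > K} < e" for n
  proof -
    have if': "integrable (P n) (\<lambda>x. f (Y n x))"
      using B by (intro measure_pmf.integrable_const_bound[where B=B]) auto
    have ig: "integrable (P n) (\<lambda>x. g (Y n x))"
      using g by (intro measure_pmf.integrable_const_bound[where B="B + e"]) auto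
    have ii: "integrable (P n) (\<lambda>x. e + (2 * B + 1) * indicator {x. norm (Y n x) > K} x)"
      using B0 e by (intro measure_pmf.integrable_const_bound[where B="e + (2 * B + 1)"])
        (auto simp: indicator_def)
    have pw: "\<bar>f (Y n x) - g (Y n x)\<bar> \<le> e + (2 * B + 1) * indicator {x. norm (Y n x) > K} x" for x
      using pointwise[of "Y n x"] by (simp add: indicator_def)
    have "\<bar>measure_pmf.expectation (P n) (\<lambda>x. f (Y n x)) - measure_pmf.expectation (P n) (\<lambda>x. g (Y n x))\<bar>
        = \<bar>\<integral>x. f (Y n x) - g (Y n x) \<partial>P n\<bar>"
      using if' ig by simp
    also have "\<dots> \<le> (\<integral>x. e + (2 * B + 1) * indicator {x. norm (Y n x) > K} x \<partial>P n)"
      using if' ig ii pw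
      by (intro integral_abs_bound[THEN order_trans] integral_mono) simp_all
    also have "\<dots> = e + (2 * B + 1) * measure_pmf.prob (P n) {x. norm (Y n x) > K}"
    proof -
      have "integrable (P n) (indicat_real {x. norm (Y n x) > K})"
        by (intro measure_pmf.integrable_const_bound[where B=1]) (auto simp: indicator_def)
      then show ?thesis by simp
    qed
    also have "\<dots> < e + (2 * B + 1) * e"
      using that B0 by simp
    finally show ?thesis .
  qed
  from g_lim have "\<forall>\<^sub>F n in sequentially.
      \<bar>measure_pmf.expectation (P n) (\<lambda>x. g (Y n x)) - (\<integral>z. g z \<partial>N)\<bar> < e"
    using e(1) by (auto simp: tendsto_iff dist_real_def)
  with K1' have "\<forall>\<^sub>F n in sequentially.
      norm (measure_pmf.expectation (P n) (\<lambda>x. f (Y n x)) - (\<integral>z. f z \<partial>N)) < r"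
  proof eventually_elim
    case (elim n)
    have "(e + (2 * B + 1) * e) + e + (e + (2 * B + 1) * e) \<le> e * (4 * B + 10)"
      using e(1) B0 by (simp add: algebra_simps)
    with dN dP[OF elim(1)] elim(2) e' show ?case
      unfolding real_norm_def by linarith
  qed
  then show "\<exists>no. \<forall>n\<ge>no. norm (measure_pmf.expectation (P n) (\<lambda>x. f (Y n x)) - (\<integral>z. f z \<partial>N)) < r"
    by (simp add: eventually_sequentially)
qed

section \<open>The bivariate normal distribution\<close>

text \<open>The affine substitution x -> \<mu> + \<sigma> x reduces the integral to the
  characteristic function of the standard normal law.\<close>

lemma integral_normal_density_cis:
  assumes "\<sigma> > 0"
  shows "integrable lborel (\<lambda>x. normal_density \<mu> \<sigma> x *\<^sub>R cis (t * x))"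
    and "(\<integral>x. normal_density \<mu> \<sigma> x *\<^sub>R cis (t * x) \<partial>lborel)
           = exp (- (\<sigma> * t)\<^sup>2 / 2) *\<^sub>R cis (t * \<mu>)"
proof -
  have [measurable]: "(\<lambda>x::real. cis (t * x)) \<in> borel_measurable borel" for t
    by (intro borel_measurable_continuous_onI continuous_intros)
  show "integrable lborel (\<lambda>x. normal_density \<mu> \<sigma> x *\<^sub>R cis (t * x))"
    by (rule Bochner_Integration.integrable_bound[OF integrable_normal_density[OF assms, of \<mu>]])
       (auto simp: normal_density_nonneg)
  have "(\<integral>x. normal_density \<mu> \<sigma> x *\<^sub>R cis (t * x) \<partial>lborel)
      = \<sigma> *\<^sub>R (\<integral>x. normal_density \<mu> \<sigma> (\<mu> + \<sigma> * x) *\<^sub>R cis (t * (\<mu> + \<sigma> * x)) \<partial>lborel)"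
    using assms by (subst lborel_integral_real_affine[where c=\<sigma> and t=\<mu>]) simp_all
  also have "\<dots> = \<sigma> *\<^sub>R (\<integral>x. (cis (t * \<mu>) / of_real \<sigma>) * (std_normal_density x *\<^sub>R cis (\<sigma> * t * x)) \<partial>lborel)"
  proof -
    have "normal_density \<mu> \<sigma> (\<mu> + \<sigma> * x) = std_normal_density x / \<sigma>" for x
      using assms by (simp add: normal_density_def power_mult_distrib real_sqrt_mult)
    moreover have "cis (t * (\<mu> + \<sigma> * x)) = cis (t * \<mu>) * cis (\<sigma> * t * x)" for x
      by (simp add: cis_mult algebra_simps)
    ultimately show ?thesis by (simp add: scaleR_conv_of_real mult_ac)
  qed
  also have "\<dots> = cis (t * \<mu>) * (\<integral>x. std_normal_density x *\<^sub>R cis (\<sigma> * t * x) \<partial>lborel)"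
    unfolding integral_mult_right_zero using assms by (simp add: scaleR_conv_of_real)
  also have "(\<integral>x. std_normal_density x *\<^sub>R cis (\<sigma> * t * x) \<partial>lborel) = char std_normal_distribution (\<sigma> * t)"
    unfolding char_def by (subst integral_density) (auto simp: normal_density_nonneg cis_conv_exp)
  finally show "(\<integral>x. normal_density \<mu> \<sigma> x *\<^sub>R cis (t * x) \<partial>lborel)
           = exp (- (\<sigma> * t)\<^sup>2 / 2) *\<^sub>R cis (t * \<mu>)"
    by (simp add: char_std_normal_distribution scaleR_conv_of_real)
qed

text \<open>Completing the square in y: the marginal density of x times the conditional density of y
  given x, whose mean is the regression line and whose variance is the Schur complement of
  \<open>s11\<close>.\<close>

lemma normal2_density_conditional:
  assumes "s11 > 0" "s11 * s22 - s12\<^sup>2 > 0"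
  shows "normal2_density s11 s12 s22 (x, y) =
    normal_density 0 (sqrt s11) x
      * normal_density (s12 / s11 * x) (sqrt ((s11 * s22 - s12\<^sup>2) / s11)) y"
proof -
  define d where "d = s11 * s22 - s12\<^sup>2"
  have d: "d > 0" "s11 * s22 = d + s12\<^sup>2" using assms by (auto simp: d_def)
  have s22: "s22 = (d + s12\<^sup>2) / s11" using d assms(1) by (simp add: field_simps)
  have "- (s22 * x\<^sup>2 - 2 * s12 * x * y + s11 * y\<^sup>2) / (2 * d) =
      - x\<^sup>2 / (2 * s11) - (y - s12 / s11 * x)\<^sup>2 / (2 * (d / s11))"
    unfolding s22 using assms(1) d(1) by (simp add: field_simps power2_eq_square)
  moreover have "2 * pi * sqrt d = sqrt (2 * pi * s11) * sqrt (2 * pi * (d / s11))"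
  proof -
    have "sqrt (2 * pi * s11) * sqrt (2 * pi * (d / s11)) = sqrt ((2 * pi)\<^sup>2 * d)"
      unfolding real_sqrt_mult[symmetric] using assms(1) by (simp add: power2_eq_square mult_ac)
    also have "\<dots> = 2 * pi * sqrt d" by (simp only: real_sqrt_mult real_sqrt_abs) simp
    finally show ?thesis by simp
  qed
  ultimately have "normal2_density s11 s12 s22 (x, y) =
      (exp (- x\<^sup>2 / (2 * s11)) * exp (- (y - s12 / s11 * x)\<^sup>2 / (2 * (d / s11))))
        / (sqrt (2 * pi * s11) * sqrt (2 * pi * (d / s11)))"
    unfolding normal2_density_def Let_def d_def[symmetric] fst_conv snd_conv exp_add[symmetric]
    by simp
  then show ?thesis
    unfolding normal_density_def d_def[symmetric] using assms(1) d(1) by simp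
qed

text \<open>Integrating over y first yields a Gaussian factor and shifts the frequency of x by
  \<open>snd w * s12 / s11\<close>, so that two one-dimensional integrals remain. The total mass is
  the case \<open>w = 0\<close>.\<close>

lemma normal2:
  assumes "s11 > 0" "s11 * s22 - s12\<^sup>2 > 0"
  shows prob_space_normal2: "prob_space (normal2 s11 s12 s22)"
    and char_normal2: "(\<integral>z. cis (w \<bullet> z) \<partial>normal2 s11 s12 s22) =
      exp (- (s11 * (fst w)\<^sup>2 + 2 * s12 * fst w * snd w + s22 * (snd w)\<^sup>2) / 2)"
proof -
  define d where "d = s11 * s22 - s12\<^sup>2"
  have d: "d > 0" "s11 * s22 = d + s12\<^sup>2" using assms by (auto simp: d_def)
  have s22: "s22 = (d + s12\<^sup>2) / s11" using d assms(1) by (simp add: field_simps)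
  let ?n = "normal_density 0 (sqrt s11)"
  let ?c = "\<lambda>x. normal_density (s12 / s11 * x) (sqrt (d / s11))"
  note dens = normal2_density_conditional[OF assms, folded d_def]
  have pos: "sqrt s11 > 0" "sqrt (d / s11) > 0" using assms d by auto
  have nonneg: "normal2_density s11 s12 s22 z \<ge> 0" for z
    by (cases z) (simp add: dens normal_density_nonneg)
  have [measurable]: "normal2_density s11 s12 s22 \<in> borel_measurable borel"
    unfolding normal2_density_def Let_def d_def[symmetric]
    by (intro borel_measurable_continuous_onI continuous_intros) (use d(1) in auto)
  have [measurable]: "(\<lambda>z::real \<times> real. cis (w \<bullet> z)) \<in> borel_measurable borel" for w
    by (intro borel_measurable_continuous_onI continuous_intros)
  have meas [measurable]: "(\<lambda>z. normal2_density s11 s12 s22 z *\<^sub>R cis (w \<bullet> z))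
      \<in> borel_measurable (lborel \<Otimes>\<^sub>M lborel)" for w
    by (simp add: lborel_prod)
  have inner: "integrable lborel (\<lambda>y. normal2_density s11 s12 s22 (x, y) *\<^sub>R cis (w \<bullet> (x, y)))"
      "(\<integral>y. normal2_density s11 s12 s22 (x, y) *\<^sub>R cis (w \<bullet> (x, y)) \<partial>lborel) =
        exp (- (sqrt (d / s11) * snd w)\<^sup>2 / 2) *\<^sub>R (?n x *\<^sub>R cis ((fst w + snd w * s12 / s11) * x))" for w x
  proof -
    have eq: "normal2_density s11 s12 s22 (x, y) *\<^sub>R cis (w \<bullet> (x, y)) =
       (of_real (?n x) * cis (fst w * x)) * (?c x y *\<^sub>R cis (snd w * y))" for y
      by (cases w) (simp add: dens scaleR_conv_of_real cis_mult[symmetric] mult_ac)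
    show "integrable lborel (\<lambda>y. normal2_density s11 s12 s22 (x, y) *\<^sub>R cis (w \<bullet> (x, y)))"
      unfolding eq by (intro integrable_mult_right integral_normal_density_cis pos)
    have "cis ((fst w + snd w * s12 / s11) * x) = cis (fst w * x) * cis (snd w * (s12 / s11 * x))"
      by (simp add: cis_mult algebra_simps)
    then show "(\<integral>y. normal2_density s11 s12 s22 (x, y) *\<^sub>R cis (w \<bullet> (x, y)) \<partial>lborel) =
        exp (- (sqrt (d / s11) * snd w)\<^sup>2 / 2) *\<^sub>R (?n x *\<^sub>R cis ((fst w + snd w * s12 / s11) * x))"
      unfolding eq integral_mult_right_zero integral_normal_density_cis(2)[OF pos(2)]
      by (simp add: scaleR_conv_of_real)
  qed
  \<comment> \<open>In modulus the inner integral is the marginal density of x, which is integrable;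
    this is the hypothesis of Fubini's theorem.\<close>
  have norm_inner: "(\<integral>y. norm (normal2_density s11 s12 s22 (x, y) *\<^sub>R cis (w \<bullet> (x, y))) \<partial>lborel) = ?n x"
    for w x
    using pos by (simp add: dens normal_density_nonneg)
  have int: "integrable (lborel \<Otimes>\<^sub>M lborel) (\<lambda>z. normal2_density s11 s12 s22 z *\<^sub>R cis (w \<bullet> z))" for w
  proof (rule lborel_pair.Fubini_integrable)
    show "integrable lborel (\<lambda>x. \<integral>y. norm (normal2_density s11 s12 s22 (x, y) *\<^sub>R cis (w \<bullet> (x, y))) \<partial>lborel)"
      unfolding norm_inner using pos by simp
  qed (use meas inner in simp_all)
  have total: "(\<integral>z. normal2_density s11 s12 s22 z *\<^sub>R cis (w \<bullet> z) \<partial>lborel) =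
      exp (- (s11 * (fst w)\<^sup>2 + 2 * s12 * fst w * snd w + s22 * (snd w)\<^sup>2) / 2)" for w
  proof -
    have "(\<integral>z. normal2_density s11 s12 s22 z *\<^sub>R cis (w \<bullet> z) \<partial>(lborel \<Otimes>\<^sub>M lborel)) =
        (\<integral>x. \<integral>y. normal2_density s11 s12 s22 (x, y) *\<^sub>R cis (w \<bullet> (x, y)) \<partial>lborel \<partial>lborel)"
      using lborel_pair.integral_fst'[OF int] by simp
    also have "\<dots> = exp (- (sqrt (d / s11) * snd w)\<^sup>2 / 2)
        * exp (- (sqrt s11 * (fst w + snd w * s12 / s11))\<^sup>2 / 2)"
      unfolding inner(2) integral_scaleR_right integral_normal_density_cis(2)[OF pos(1)]
      by (simp add: scaleR_conv_of_real)
    also have "exp (- (sqrt (d / s11) * snd w)\<^sup>2 / 2)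
        * exp (- (sqrt s11 * (fst w + snd w * s12 / s11))\<^sup>2 / 2)
        = exp (- (s11 * (fst w)\<^sup>2 + 2 * s12 * fst w * snd w + s22 * (snd w)\<^sup>2) / 2)"
    proof -
      have "(sqrt (d / s11) * snd w)\<^sup>2 + (sqrt s11 * (fst w + snd w * s12 / s11))\<^sup>2
          = d / s11 * (snd w)\<^sup>2 + s11 * (fst w + snd w * s12 / s11)\<^sup>2"
        using assms(1) d(1) by (simp add: power_mult_distrib)
      also have "\<dots> = s11 * (fst w)\<^sup>2 + 2 * s12 * fst w * snd w + s22 * (snd w)\<^sup>2"
        unfolding s22 using assms(1) by (simp add: field_simps power2_eq_square)
      finally show ?thesis
        unfolding exp_add[symmetric] by (simp add: add_divide_distrib[symmetric] algebra_simps)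
    qed
    finally show ?thesis by (simp add: lborel_prod)
  qed
  show "(\<integral>z. cis (w \<bullet> z) \<partial>normal2 s11 s12 s22) =
      exp (- (s11 * (fst w)\<^sup>2 + 2 * s12 * fst w * snd w + s22 * (snd w)\<^sup>2) / 2)"
    unfolding normal2_def using nonneg by (subst integral_density) (auto simp: total)
  show "prob_space (normal2 s11 s12 s22)"
  proof
    have i: "integrable lborel (\<lambda>z. normal2_density s11 s12 s22 z *\<^sub>R (1::complex))"
      using int[of 0] by (simp add: lborel_prod)
    have "(\<integral>z. normal2_density s11 s12 s22 z *\<^sub>R (1::complex) \<partial>lborel) = 1"
      using total[of 0] by simp
    then have 1: "(\<integral>z. normal2_density s11 s12 s22 z \<partial>lborel) = 1"
      unfolding scaleR_conv_of_real by simp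
    have "integrable lborel (normal2_density s11 s12 s22)"
      using integrable_Re[OF i] by simp
    then have "(\<integral>\<^sup>+z. ennreal (normal2_density s11 s12 s22 z) \<partial>lborel) = 1"
      using nonneg 1 by (subst nn_integral_eq_integral) auto
    then show "emeasure (normal2 s11 s12 s22) (space (normal2 s11 s12 s22)) = 1"
      unfolding normal2_def by (subst emeasure_density) auto
  qed
qed

section \<open>Convergence in probability\<close>

text \<open>The law depends on n because paths of different lengths live on different spaces of
  lists; as the limit is a constant, no common probability space is required.\<close>

definition tendsto_prob ::
    "(nat \<Rightarrow> 'b pmf) \<Rightarrow> (nat \<Rightarrow> 'b \<Rightarrow> 'a::metric_space) \<Rightarrow> 'a \<Rightarrow> bool" where
  "tendsto_prob P f c \<longleftrightarrow>
     (\<forall>e>0. (\<lambda>n. measure_pmf.prob (P n) {x. dist (f n x) c > e}) \<longlonglongrightarrow> 0)"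

definition tight_prob ::
    "(nat \<Rightarrow> 'b pmf) \<Rightarrow> (nat \<Rightarrow> 'b \<Rightarrow> 'a::real_normed_vector) \<Rightarrow> bool" where
  "tight_prob P f \<longleftrightarrow>
     (\<forall>e>0. \<exists>K. \<forall>\<^sub>F n in sequentially. measure_pmf.prob (P n) {x. norm (f n x) > K} < e)"

lemma prob_tendsto_0_mono:
  assumes "(\<lambda>n. measure_pmf.prob (P n) (B n)) \<longlonglongrightarrow> 0"
    and "\<And>n x. x \<in> set_pmf (P n) \<Longrightarrow> x \<in> A n \<Longrightarrow> x \<in> B n"
  shows "(\<lambda>n. measure_pmf.prob (P n) (A n)) \<longlonglongrightarrow> 0"
proof (rule tendsto_sandwich[OF _ _ tendsto_const assms(1)])
  show "\<forall>\<^sub>F n in sequentially. measure_pmf.prob (P n) (A n) \<le> measure_pmf.prob (P n) (B n)"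
  proof (intro always_eventually allI)
    fix n
    have "AE x in P n. x \<in> A n \<longrightarrow> x \<in> B n"
      using assms(2) by (simp add: AE_measure_pmf_iff)
    then show "measure_pmf.prob (P n) (A n) \<le> measure_pmf.prob (P n) (B n)"
      by (intro measure_pmf.finite_measure_mono_AE) simp_all
  qed
qed simp

lemma prob_tendsto_0_Un:
  assumes "(\<lambda>n. measure_pmf.prob (P n) (A n)) \<longlonglongrightarrow> 0"
    and "(\<lambda>n. measure_pmf.prob (P n) (B n)) \<longlonglongrightarrow> 0"
  shows "(\<lambda>n. measure_pmf.prob (P n) (A n \<union> B n)) \<longlonglongrightarrow> 0"
proof (rule tendsto_sandwich[OF _ _ tendsto_const])
  show "(\<lambda>n. measure_pmf.prob (P n) (A n) + measure_pmf.prob (P n) (B n)) \<longlonglongrightarrow> 0"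
    using tendsto_add[OF assms] by simp
qed (simp_all add: measure_Un_le)

lemma prob_tendsto_1_iff:
  "(\<lambda>n. measure_pmf.prob (P n) (A n)) \<longlonglongrightarrow> 1 \<longleftrightarrow> (\<lambda>n. measure_pmf.prob (P n) (- A n)) \<longlonglongrightarrow> 0"
proof -
  have "measure_pmf.prob (P n) (- A n) = 1 - measure_pmf.prob (P n) (A n)" for n
    using measure_pmf.prob_compl[of "A n" "P n"] by (simp add: Compl_eq_Diff_UNIV)
  then have *: "measure_pmf.prob (P n) (A n) = 1 - measure_pmf.prob (P n) (- A n)"
      "measure_pmf.prob (P n) (- A n) = 1 - measure_pmf.prob (P n) (A n)" for n by simp_all
  show ?thesis
  proof
    assume "(\<lambda>n. measure_pmf.prob (P n) (A n)) \<longlonglongrightarrow> 1"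
    from tendsto_diff[OF tendsto_const[of 1] this] show "(\<lambda>n. measure_pmf.prob (P n) (- A n)) \<longlonglongrightarrow> 0"
      by (simp flip: *(2))
  next
    assume "(\<lambda>n. measure_pmf.prob (P n) (- A n)) \<longlonglongrightarrow> 0"
    from tendsto_diff[OF tendsto_const[of 1] this] show "(\<lambda>n. measure_pmf.prob (P n) (A n)) \<longlonglongrightarrow> 1"
      by (simp flip: *(1))
  qed
qed

lemma prob_tendsto_1_mono:
  assumes "(\<lambda>n. measure_pmf.prob (P n) (A n)) \<longlonglongrightarrow> 1" "\<And>n. A n \<subseteq> B n"
  shows "(\<lambda>n. measure_pmf.prob (P n) (B n)) \<longlonglongrightarrow> 1"
  using assms unfolding prob_tendsto_1_iff by (auto elim!: prob_tendsto_0_mono)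

text \<open>Serves to discard exceptional paths: a condition that holds in a neighbourhood of the
  limit, such as a positive denominator, holds with probability tending to 1.\<close>

lemma tendsto_prob_open:
  assumes "tendsto_prob P f c" "open S" "c \<in> S"
  shows "(\<lambda>n. measure_pmf.prob (P n) {x. f n x \<in> S}) \<longlonglongrightarrow> 1"
proof -
  obtain e where e: "e > 0" "\<And>y. dist y c < e \<Longrightarrow> y \<in> S"
    using assms(2,3) unfolding open_dist by blast
  have "(\<lambda>n. measure_pmf.prob (P n) {x. dist (f n x) c > e / 2}) \<longlonglongrightarrow> 0"
    using assms(1) half_gt_zero[OF e(1)] unfolding tendsto_prob_def by blast
  then have "(\<lambda>n. measure_pmf.prob (P n) (- {x. f n x \<in> S})) \<longlonglongrightarrow> 0"
    by (rule prob_tendsto_0_mono) (use e in \<open>force simp: not_less[symmetric]\<close>)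
  then show ?thesis by (simp only: prob_tendsto_1_iff)
qed

text \<open>Continuity at the limit point alone suffices. Combined with pairing, this yields the
  arithmetic rules, including division when the limit of the denominator is nonzero.\<close>

lemma tendsto_prob_isCont:
  assumes "tendsto_prob P f c" "isCont F c"
  shows "tendsto_prob P (\<lambda>n x. F (f n x)) (F c)"
  unfolding tendsto_prob_def
proof (intro allI impI)
  fix e :: real assume "e > 0"
  then obtain d where d: "d > 0" "\<And>y. dist y c < d \<Longrightarrow> dist (F y) (F c) < e"
    using assms(2) unfolding continuous_at_eps_delta by blast
  have "(\<lambda>n. measure_pmf.prob (P n) {x. dist (f n x) c > d / 2}) \<longlonglongrightarrow> 0"
    using assms(1) half_gt_zero[OF d(1)] unfolding tendsto_prob_def by blast
  then show "(\<lambda>n. measure_pmf.prob (P n) {x. dist (F (f n x)) (F c) > e}) \<longlonglongrightarrow> 0"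
  proof (rule prob_tendsto_0_mono)
    fix n x assume "x \<in> {x. dist (F (f n x)) (F c) > e}"
    then have "\<not> dist (f n x) c < d" using d(2)[of "f n x"] by auto
    then show "x \<in> {x. dist (f n x) c > d / 2}" using d(1) by simp
  qed
qed

lemma tendsto_prob_Pair:
  assumes "tendsto_prob P f c" "tendsto_prob P g d"
  shows "tendsto_prob P (\<lambda>n x. (f n x, g n x)) (c, d)"
  unfolding tendsto_prob_def
proof (intro allI impI)
  fix e :: real assume e: "e > 0"
  have "(\<lambda>n. measure_pmf.prob (P n) ({x. dist (f n x) c > e / 2} \<union> {x. dist (g n x) d > e / 2})) \<longlonglongrightarrow> 0"
    using assms half_gt_zero[OF e] unfolding tendsto_prob_def by (intro prob_tendsto_0_Un) blast+
  then show "(\<lambda>n. measure_pmf.prob (P n) {x. dist (f n x, g n x) (c, d) > e}) \<longlonglongrightarrow> 0"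
  proof (rule prob_tendsto_0_mono)
    fix n x assume "x \<in> {x. dist (f n x, g n x) (c, d) > e}"
    moreover have "dist (f n x, g n x) (c, d) \<le> dist (f n x) c + dist (g n x) d"
      unfolding dist_Pair_Pair by (rule sqrt_sum_squares_le_sum) simp_all
    ultimately show "x \<in> {x. dist (f n x) c > e / 2} \<union> {x. dist (g n x) d > e / 2}"
      by auto
  qed
qed

lemma tendsto_prob_const:
  assumes "a \<longlonglongrightarrow> c"
  shows "tendsto_prob P (\<lambda>n x. a n) c"
  unfolding tendsto_prob_def
proof (intro allI impI)
  fix e :: real assume "e > 0"
  with assms have "\<forall>\<^sub>F n in sequentially. dist (a n) c < e" by (simp add: tendsto_iff)
  then have "\<forall>\<^sub>F n in sequentially. measure_pmf.prob (P n) {x. dist (a n) c > e} = 0"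
    by eventually_elim simp
  then show "(\<lambda>n. measure_pmf.prob (P n) {x. dist (a n) c > e}) \<longlonglongrightarrow> 0"
    by (rule tendsto_eventually)
qed

lemma tendsto_prob_cong:
  assumes "tendsto_prob P f c" "(\<lambda>n. measure_pmf.prob (P n) {x. f n x = g n x}) \<longlonglongrightarrow> 1"
  shows "tendsto_prob P g c"
  unfolding tendsto_prob_def
proof (intro allI impI)
  fix e :: real assume e: "e > 0"
  have "(\<lambda>n. measure_pmf.prob (P n) ({x. dist (f n x) c > e} \<union> - {x. f n x = g n x})) \<longlonglongrightarrow> 0"
    using assms e unfolding tendsto_prob_def prob_tendsto_1_iff by (intro prob_tendsto_0_Un) simp_all
  then show "(\<lambda>n. measure_pmf.prob (P n) {x. dist (g n x) c > e}) \<longlonglongrightarrow> 0"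
    by (rule prob_tendsto_0_mono) auto
qed

lemma tendsto_prob_add:
  fixes c d :: "'a::real_normed_vector"
  assumes "tendsto_prob P f c" "tendsto_prob P g d"
  shows "tendsto_prob P (\<lambda>n x. f n x + g n x) (c + d)"
  using tendsto_prob_isCont[OF tendsto_prob_Pair[OF assms], of "\<lambda>z. fst z + snd z"] by simp

lemma tendsto_prob_mult:
  fixes c d :: "'a::real_normed_algebra"
  assumes "tendsto_prob P f c" "tendsto_prob P g d"
  shows "tendsto_prob P (\<lambda>n x. f n x * g n x) (c * d)"
  using tendsto_prob_isCont[OF tendsto_prob_Pair[OF assms], of "\<lambda>z. fst z * snd z"] by simp

lemma tendsto_prob_divide:
  fixes c d :: "'a::real_normed_field"
  assumes "tendsto_prob P f c" "tendsto_prob P g d" "d \<noteq> 0"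
  shows "tendsto_prob P (\<lambda>n x. f n x / g n x) (c / d)"
  using tendsto_prob_isCont[OF tendsto_prob_Pair[OF assms(1,2)], of "\<lambda>z. fst z / snd z"] assms(3)
  by simp

text \<open>The Slutsky rule for products: outside an event of small probability the tight factor is
  at most \<open>L\<close>, and the other factor is eventually at most e / L with high
  probability.\<close>

lemma tight_prob_mult_null:
  fixes f g :: "nat \<Rightarrow> 'b \<Rightarrow> real"
  assumes "tight_prob P f" "tendsto_prob P g 0"
  shows "tendsto_prob P (\<lambda>n x. f n x * g n x) 0"
  unfolding tendsto_prob_def
proof (intro allI impI)
  fix e :: real assume e: "e > 0"
  show "(\<lambda>n. measure_pmf.prob (P n) {x. dist (f n x * g n x) 0 > e}) \<longlonglongrightarrow> 0"
  proof (rule order_tendstoI)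
    fix r :: real assume "r > 0"
    then obtain K where K: "\<forall>\<^sub>F n in sequentially. measure_pmf.prob (P n) {x. norm (f n x) > K} < r / 2"
      using assms(1) unfolding tight_prob_def by (meson half_gt_zero)
    \<comment> \<open>The maximum with 1 makes the bound positive, so that dividing by it is
      safe.\<close>
    define L where "L = max K 1"
    have L: "L > 0" "K \<le> L" by (auto simp: L_def)
    have "(\<lambda>n. measure_pmf.prob (P n) {x. dist (g n x) 0 > e / L}) \<longlonglongrightarrow> 0"
      using assms(2) e L unfolding tendsto_prob_def by simp
    then have "\<forall>\<^sub>F n in sequentially. measure_pmf.prob (P n) {x. dist (g n x) 0 > e / L} < r / 2"
      by (rule order_tendstoD(2)) (rule half_gt_zero[OF \<open>r > 0\<close>])
    with K show "\<forall>\<^sub>F n in sequentially. measure_pmf.prob (P n) {x. dist (f n x * g n x) 0 > e} < r"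
    proof eventually_elim
      case (elim n)
      have "measure_pmf.prob (P n) {x. dist (f n x * g n x) 0 > e} \<le>
          measure_pmf.prob (P n) ({x. norm (f n x) > K} \<union> {x. dist (g n x) 0 > e / L})"
      proof (intro measure_pmf.finite_measure_mono subsetI, rule ccontr)
        fix x assume x: "x \<in> {x. dist (f n x * g n x) 0 > e}"
          "x \<notin> {x. norm (f n x) > K} \<union> {x. dist (g n x) 0 > e / L}"
        then have "\<bar>f n x\<bar> \<le> L" "\<bar>g n x\<bar> \<le> e / L" using L(2) by simp_all
        then have "\<bar>f n x\<bar> * \<bar>g n x\<bar> \<le> L * (e / L)" using L(1) by (intro mult_mono) auto
        then show False using x(1) L(1) by (simp add: abs_mult)
      qed simp
      also have "\<dots> \<le> measure_pmf.prob (P n) {x. norm (f n x) > K} + measure_pmf.prob (P n) {x. dist (g n x) 0 > e / L}"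
        by (intro measure_Un_le) simp_all
      finally show ?case using elim by simp
    qed
  qed (simp add: less_le_trans)
qed

lemma tight_prob_bounded_linear:
  assumes "tight_prob P f" "bounded_linear T"
  shows "tight_prob P (\<lambda>n x. T (f n x))"
  unfolding tight_prob_def
proof (intro allI impI)
  fix e :: real assume "e > 0"
  then obtain K where K: "\<forall>\<^sub>F n in sequentially. measure_pmf.prob (P n) {x. norm (f n x) > K} < e"
    using assms(1) unfolding tight_prob_def by blast
  obtain B where B: "B > 0" "\<And>z. norm (T z) \<le> norm z * B"
    using bounded_linear.pos_bounded[OF assms(2)] by blast
  from K have "\<forall>\<^sub>F n in sequentially. measure_pmf.prob (P n) {x. norm (T (f n x)) > K * B} < e"
  proof eventually_elim
    case (elim n)
    have "measure_pmf.prob (P n) {x. norm (T (f n x)) > K * B} \<le> measure_pmf.prob (P n) {x. norm (f n x) > K}"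
    proof (intro measure_pmf.finite_measure_mono subsetI)
      fix x assume "x \<in> {x. norm (T (f n x)) > K * B}"
      with B(2)[of "f n x"] have "K * B < norm (f n x) * B" by simp
      then show "x \<in> {x. norm (f n x) > K}" using B(1) by simp
    qed simp
    with elim show ?case by simp
  qed
  then show "\<exists>K. \<forall>\<^sub>F n in sequentially. measure_pmf.prob (P n) {x. norm (T (f n x)) > K} < e" by blast
qed

lemma tight_prob_add_null:
  fixes f g :: "nat \<Rightarrow> 'b \<Rightarrow> 'a::real_normed_vector"
  assumes "tight_prob P f" "tendsto_prob P (\<lambda>n x. g n x - f n x) 0"
  shows "tight_prob P g"
  unfolding tight_prob_def
proof (intro allI impI)
  fix e :: real assume e: "e > 0"
  then obtain K where K: "\<forall>\<^sub>F n in sequentially. measure_pmf.prob (P n) {x. norm (f n x) > K} < e / 2"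
    using assms(1) unfolding tight_prob_def by (meson half_gt_zero)
  have "(\<lambda>n. measure_pmf.prob (P n) {x. dist (g n x - f n x) 0 > 1}) \<longlonglongrightarrow> 0"
    using assms(2) unfolding tendsto_prob_def by simp
  then have "\<forall>\<^sub>F n in sequentially. measure_pmf.prob (P n) {x. dist (g n x - f n x) 0 > 1} < e / 2"
    by (rule order_tendstoD(2)) (rule half_gt_zero[OF e])
  with K have "\<forall>\<^sub>F n in sequentially. measure_pmf.prob (P n) {x. norm (g n x) > K + 1} < e"
  proof eventually_elim
    case (elim n)
    have "measure_pmf.prob (P n) {x. norm (g n x) > K + 1} \<le>
        measure_pmf.prob (P n) ({x. norm (f n x) > K} \<union> {x. dist (g n x - f n x) 0 > 1})"
    proof (intro measure_pmf.finite_measure_mono subsetI)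
      fix x assume "x \<in> {x. norm (g n x) > K + 1}"
      with norm_triangle_sub[of "g n x" "f n x"]
      show "x \<in> {x. norm (f n x) > K} \<union> {x. dist (g n x - f n x) 0 > 1}" by auto
    qed simp
    also have "\<dots> \<le> measure_pmf.prob (P n) {x. norm (f n x) > K} + measure_pmf.prob (P n) {x. dist (g n x - f n x) 0 > 1}"
      by (intro measure_Un_le) simp_all
    finally show ?case using elim by simp
  qed
  then show "\<exists>K. \<forall>\<^sub>F n in sequentially. measure_pmf.prob (P n) {x. norm (g n x) > K} < e" by blast
qed

text \<open>Markov's inequality for the squared norm. The choice K^2 = (|C| + 1) / e makes C / K^2 <
  e and keeps K positive for every real \<open>C\<close>.\<close>

lemma tight_prob_second_moment:
  fixes P :: "nat \<Rightarrow> 'b pmf" and f :: "nat \<Rightarrow> 'b \<Rightarrow> 'a::real_normed_vector"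
  assumes "\<And>n. integrable (P n) (\<lambda>x. (norm (f n x))\<^sup>2)"
    and "\<And>n. measure_pmf.expectation (P n) (\<lambda>x. (norm (f n x))\<^sup>2) \<le> C"
  shows "tight_prob P f"
  unfolding tight_prob_def
proof (intro allI impI)
  fix e :: real assume e: "e > 0"
  define K where "K = sqrt ((\<bar>C\<bar> + 1) / e)"
  have K: "K > 0" "K\<^sup>2 = (\<bar>C\<bar> + 1) / e" using e by (simp_all add: K_def add_nonneg_pos)
  have "measure_pmf.prob (P n) {x. norm (f n x) > K} < e" for n
  proof -
    have "measure_pmf.prob (P n) {x. norm (f n x) > K} \<le> measure_pmf.prob (P n) {x \<in> space (P n). K\<^sup>2 \<le> (norm (f n x))\<^sup>2}"
      using K(1) by (intro measure_pmf.finite_measure_mono) (auto intro: power_mono)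
    also have "\<dots> \<le> measure_pmf.expectation (P n) (\<lambda>x. (norm (f n x))\<^sup>2) / K\<^sup>2"
      using K(1) assms(1) by (intro integral_Markov_inequality_measure[where A="{}"]) auto
    also have "\<dots> \<le> C / K\<^sup>2" using assms(2) by (intro divide_right_mono) simp_all
    also have "\<dots> < e"
    proof -
      have "C * e < (\<bar>C\<bar> + 1) * e" using e by (intro mult_strict_right_mono) auto
      then show ?thesis unfolding K(2) using e by (simp add: field_simps)
    qed
    finally show ?thesis .
  qed
  then show "\<exists>K. \<forall>\<^sub>F n in sequentially. measure_pmf.prob (P n) {x. norm (f n x) > K} < e"
    by (intro exI[of _ K] always_eventually allI)
qed

text \<open>The error is at most r / 2 where \<open>f\<close> is close to \<open>c\<close>, and at
  most a constant on the remaining event, whose probability vanishes.\<close>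

lemma tendsto_prob_bounded_L1:
  fixes f :: "nat \<Rightarrow> 'b \<Rightarrow> 'a::real_normed_vector"
  assumes "tendsto_prob P f c" and B: "\<And>n x. x \<in> set_pmf (P n) \<Longrightarrow> norm (f n x) \<le> B"
  shows "(\<lambda>n. measure_pmf.expectation (P n) (\<lambda>x. norm (f n x - c))) \<longlonglongrightarrow> 0"
proof (rule order_tendstoI)
  fix r :: real assume "r > 0"
  define C where "C = \<bar>B\<bar> + norm c + 1"
  have C: "C > 0" by (simp add: C_def add_nonneg_pos)
  have "(\<lambda>n. measure_pmf.prob (P n) {x. dist (f n x) c > r / 2}) \<longlonglongrightarrow> 0"
    using assms(1) half_gt_zero[OF \<open>r > 0\<close>] unfolding tendsto_prob_def by blast
  then have "\<forall>\<^sub>F n in sequentially. measure_pmf.prob (P n) {x. dist (f n x) c > r / 2} < r / (2 * C)"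
    by (rule order_tendstoD(2)) (intro divide_pos_pos mult_pos_pos \<open>r > 0\<close> C zero_less_numeral)
  then show "\<forall>\<^sub>F n in sequentially. measure_pmf.expectation (P n) (\<lambda>x. norm (f n x - c)) < r"
  proof eventually_elim
    case (elim n)
    have le: "norm (f n x - c) \<le> C" if "x \<in> set_pmf (P n)" for x
      using B[OF that] norm_triangle_ineq4[of "f n x" c] by (simp add: C_def)
    have i: "integrable (P n) (indicat_real {x. dist (f n x) c > r / 2})"
      by (intro measure_pmf.integrable_const_bound[where B=1]) (auto simp: indicator_def)
    have "measure_pmf.expectation (P n) (\<lambda>x. norm (f n x - c)) \<le>
       measure_pmf.expectation (P n) (\<lambda>x. r / 2 + C * indicator {x. dist (f n x) c > r / 2} x)"
    proof (rule integral_mono_AE)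
      show "integrable (P n) (\<lambda>x. norm (f n x - c))"
        using le by (intro measure_pmf.integrable_const_bound[where B=C]) (auto simp: AE_measure_pmf_iff)
      show "AE x in P n. norm (f n x - c) \<le> r / 2 + C * indicator {x. dist (f n x) c > r / 2} x"
        using le \<open>r > 0\<close> by (auto simp: AE_measure_pmf_iff indicator_def dist_norm add_increasing)
    qed (use i in simp)
    also have "\<dots> = r / 2 + C * measure_pmf.prob (P n) {x. dist (f n x) c > r / 2}"
      using i by simp
    also have "\<dots> < r" using elim C by (simp add: field_simps)
    finally show ?case .
  qed
next
  fix r :: real assume "r < 0"
  then have "r < measure_pmf.expectation (P n) (\<lambda>x. norm (f n x - c))" for n
    by (rule less_le_trans) (intro integral_nonneg_AE always_eventually allI norm_ge_zero)
  then show "\<forall>\<^sub>F n in sequentially. r < measure_pmf.expectation (P n) (\<lambda>x. norm (f n x - c))"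
    by simp
qed

text \<open>Since \<open>cis\<close> has modulus one, the two integrands differ in norm by |cis (w .
  (Z - Y)) - 1|, which is bounded and null in probability, hence null in mean.\<close>

lemma characteristic_function_slutsky:
  fixes Y Z :: "nat \<Rightarrow> 'b \<Rightarrow> 'a::euclidean_space"
  assumes "tendsto_prob P (\<lambda>n x. Z n x - Y n x) 0"
    and "(\<lambda>n. measure_pmf.expectation (P n) (\<lambda>x. cis (w \<bullet> Y n x))) \<longlonglongrightarrow> c"
  shows "(\<lambda>n. measure_pmf.expectation (P n) (\<lambda>x. cis (w \<bullet> Z n x))) \<longlonglongrightarrow> c"
proof -
  have "isCont (\<lambda>z. cis (w \<bullet> z)) 0"
    unfolding cis_conv_exp by (intro continuous_intros)
  then have "tendsto_prob P (\<lambda>n x. cis (w \<bullet> (Z n x - Y n x))) 1"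
    using tendsto_prob_isCont[OF assms(1)] by fastforce
  then have lim: "(\<lambda>n. measure_pmf.expectation (P n) (\<lambda>x. norm (cis (w \<bullet> (Z n x - Y n x)) - 1))) \<longlonglongrightarrow> 0"
    by (rule tendsto_prob_bounded_L1[where B=1]) simp
  have i: "integrable (P n) (\<lambda>x. cis (h x))" for n h
    by (intro measure_pmf.integrable_const_bound[where B=1]) auto
  have "(\<lambda>n. measure_pmf.expectation (P n) (\<lambda>x. cis (w \<bullet> Z n x))
      - measure_pmf.expectation (P n) (\<lambda>x. cis (w \<bullet> Y n x))) \<longlonglongrightarrow> 0"
  proof (rule Lim_null_comparison[OF _ lim], intro always_eventually allI)
    fix n
    have "norm (cis (w \<bullet> Z n x) - cis (w \<bullet> Y n x)) = norm (cis (w \<bullet> (Z n x - Y n x)) - 1)" for x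
    proof -
      have "cis (w \<bullet> Z n x) - cis (w \<bullet> Y n x) = cis (w \<bullet> Y n x) * (cis (w \<bullet> (Z n x - Y n x)) - 1)"
        by (simp add: right_diff_distrib cis_mult inner_diff_right)
      then show ?thesis by (simp add: norm_mult)
    qed
    then show "norm (measure_pmf.expectation (P n) (\<lambda>x. cis (w \<bullet> Z n x))
      - measure_pmf.expectation (P n) (\<lambda>x. cis (w \<bullet> Y n x)))
      \<le> measure_pmf.expectation (P n) (\<lambda>x. norm (cis (w \<bullet> (Z n x - Y n x)) - 1))"
      using integral_norm_bound[of "P n" "\<lambda>x. cis (w \<bullet> Z n x) - cis (w \<bullet> Y n x)"] i by simp
  qed
  from tendsto_add[OF this assms(2)] show ?thesis by simp
qed

lemma tendsto_prob_bound:
  assumes "\<forall>\<^sub>F n in sequentially. \<forall>x\<in>set_pmf (P n). dist (f n x) c \<le> a n" "a \<longlonglongrightarrow> 0"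
  shows "tendsto_prob P f c"
  unfolding tendsto_prob_def
proof (intro allI impI)
  fix e :: real assume "e > 0"
  with assms(2) have "\<forall>\<^sub>F n in sequentially. a n < e" by (rule order_tendstoD(2))
  with assms(1) have "\<forall>\<^sub>F n in sequentially. measure_pmf.prob (P n) {x. dist (f n x) c > e} = 0"
    by eventually_elim (fastforce simp: measure_pmf_zero_iff)
  then show "(\<lambda>n. measure_pmf.prob (P n) {x. dist (f n x) c > e}) \<longlonglongrightarrow> 0"
    by (rule tendsto_eventually)
qed

text \<open>The restriction to \<open>n > 0\<close> admits identities that divide by n.\<close>

lemma tendsto_prob_cong_support:
  assumes "tendsto_prob P f c" "\<And>n x. n > 0 \<Longrightarrow> x \<in> set_pmf (P n) \<Longrightarrow> f n x = g n x"
  shows "tendsto_prob P g c"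
proof (rule tendsto_prob_cong[OF assms(1)], rule tendsto_eventually)
  have "\<forall>\<^sub>F n in sequentially. n > (0::nat)" by (rule eventually_gt_at_top)
  then show "\<forall>\<^sub>F n in sequentially. measure_pmf.prob (P n) {x. f n x = g n x} = 1"
  proof eventually_elim
    case (elim n)
    then have "AE x in P n. x \<in> {x. f n x = g n x}" using assms(2) by (simp add: AE_measure_pmf_iff)
    then show ?case by (subst measure_pmf.prob_eq_1) simp_all
  qed
qed

section \<open>The path law of the chain\<close>

definition bernoulli_nat_pmf :: "real \<Rightarrow> nat pmf" where
  "bernoulli_nat_pmf p = map_pmf of_bool (bernoulli_pmf p)"

primrec path_pmf :: "real \<Rightarrow> real \<Rightarrow> real \<Rightarrow> nat \<Rightarrow> nat list pmf" where
  "path_pmf p \<alpha> \<beta> 0 = map_pmf (\<lambda>i. [i]) (bernoulli_nat_pmf p)"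
| "path_pmf p \<alpha> \<beta> (Suc n) = path_pmf p \<alpha> \<beta> n \<bind>
     (\<lambda>xs. map_pmf (\<lambda>j. xs @ [j]) (bernoulli_nat_pmf (if last xs = 0 then \<alpha> else \<beta>)))"

lemma set_bernoulli_nat_pmf: "set_pmf (bernoulli_nat_pmf p) \<subseteq> {0, 1}"
  by (auto simp: bernoulli_nat_pmf_def)

lemma pmf_bernoulli_nat:
  assumes "0 \<le> p" "p \<le> 1"
  shows "pmf (bernoulli_nat_pmf p) j = (if j = 0 then 1 - p else if j = 1 then p else 0)"
proof -
  have inj: "inj (of_bool :: bool \<Rightarrow> nat)" by (auto simp: inj_def)
  have "pmf (bernoulli_nat_pmf p) 0 = 1 - p" "pmf (bernoulli_nat_pmf p) 1 = p"
    using assms pmf_map_inj'[OF inj, of "bernoulli_pmf p" False] pmf_map_inj'[OF inj, of "bernoulli_pmf p" True]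
    by (simp_all add: bernoulli_nat_pmf_def)
  moreover have "pmf (bernoulli_nat_pmf p) j = 0" if "j \<notin> {0, 1}"
    using that set_bernoulli_nat_pmf[of p] by (auto simp: pmf_eq_0_set_pmf)
  ultimately show ?thesis by auto
qed

lemma expectation_bernoulli_nat:
  fixes f :: "nat \<Rightarrow> 'a::{banach, second_countable_topology}"
  assumes "0 \<le> p" "p \<le> 1"
  shows "measure_pmf.expectation (bernoulli_nat_pmf p) f = (1 - p) *\<^sub>R f 0 + p *\<^sub>R f 1"
  using integral_measure_pmf[of "{0, 1}" "bernoulli_nat_pmf p" f] set_bernoulli_nat_pmf[of p]
    pmf_bernoulli_nat[OF assms]
  by auto

lemma set_path_pmf:
  "xs \<in> set_pmf (path_pmf p \<alpha> \<beta> n) \<Longrightarrow> length xs = Suc n \<and> set xs \<subseteq> {0, 1}"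
  using set_bernoulli_nat_pmf by (induction n arbitrary: xs) fastforce+

text \<open>Finiteness of the support makes every function of the path integrable.\<close>

lemma finite_set_path_pmf: "finite (set_pmf (path_pmf p \<alpha> \<beta> n))"
proof (rule finite_subset)
  show "set_pmf (path_pmf p \<alpha> \<beta> n) \<subseteq> {xs. set xs \<subseteq> {0, 1} \<and> length xs = Suc n}"
    using set_path_pmf by blast
qed (rule finite_lists_length_eq, simp)

lemma integrable_path_pmf [simp]:
  fixes f :: "nat list \<Rightarrow> 'a::{banach, second_countable_topology}"
  shows "integrable (path_pmf p \<alpha> \<beta> n) f"
  by (intro integrable_measure_pmf_finite finite_set_path_pmf)

text \<open>The one-step conditional expectation given the past, in elementary form. All martingale
  computations below go through it.\<close>

lemma expectation_path_Suc:
  fixes f :: "nat list \<Rightarrow> 'a::{banach, second_countable_topology}"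
  assumes "0 \<le> \<alpha>" "\<alpha> \<le> 1" "0 \<le> \<beta>" "\<beta> \<le> 1"
  shows "measure_pmf.expectation (path_pmf p \<alpha> \<beta> (Suc n)) f =
    measure_pmf.expectation (path_pmf p \<alpha> \<beta> n)
      (\<lambda>xs. (1 - (if last xs = 0 then \<alpha> else \<beta>)) *\<^sub>R f (xs @ [0])
        + (if last xs = 0 then \<alpha> else \<beta>) *\<^sub>R f (xs @ [1]))"
proof -
  have 1: "measure_pmf.expectation (map_pmf (\<lambda>j. xs @ [j]) (bernoulli_nat_pmf (if last xs = 0 then \<alpha> else \<beta>))) f
     = (1 - (if last xs = 0 then \<alpha> else \<beta>)) *\<^sub>R f (xs @ [0])
        + (if last xs = 0 then \<alpha> else \<beta>) *\<^sub>R f (xs @ [1])" for xs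
    using assms by (subst integral_map_pmf, subst expectation_bernoulli_nat) auto
  show ?thesis
    unfolding path_pmf.simps
    by (subst pmf_expectation_bind[OF finite_set_path_pmf[of p \<alpha> \<beta> n]])
       (simp_all only: finite_imageI finite_subset[OF set_bernoulli_nat_pmf] finite.intros set_map_pmf 1
          integral_measure_pmf[OF finite_set_path_pmf[of p \<alpha> \<beta> n]] order_refl)
qed

lemma pmf_path_0: "pmf (path_pmf p \<alpha> \<beta> 0) [i] = pmf (bernoulli_nat_pmf p) i"
  using pmf_map_inj'[of "\<lambda>i. [i]" "bernoulli_nat_pmf p" i] by (simp add: inj_def)

lemma pmf_path_Suc:
  "pmf (path_pmf p \<alpha> \<beta> (Suc n)) (xs @ [j]) =
    pmf (path_pmf p \<alpha> \<beta> n) xs * pmf (bernoulli_nat_pmf (if last xs = 0 then \<alpha> else \<beta>)) j"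
proof -
  let ?K = "\<lambda>ys. bernoulli_nat_pmf (if last ys = 0 then \<alpha> else \<beta>)"
  have "pmf (map_pmf (\<lambda>j. ys @ [j]) (?K ys)) (xs @ [j]) = indicator {xs} ys * pmf (?K xs) j" for ys
  proof (cases "ys = xs")
    case True
    then show ?thesis
      using pmf_map_inj'[of "\<lambda>j. xs @ [j]" "?K xs" j] by (simp add: inj_def)
  next
    case False
    then show ?thesis by (auto simp: pmf_eq_0_set_pmf)
  qed
  then show ?thesis by (simp add: pmf_bind measure_pmf_single)
qed

lemma trans_prob_bounds:
  assumes "0 < a" "a < 1" "0 < p" "p < 1"
  shows "0 < trans_prob a p 0 1" "trans_prob a p 0 1 < 1"
    "0 < trans_prob a p 1 1" "trans_prob a p 1 1 < 1"
proof -
  have ap: "0 < a * p" "a * p < a" using assms by simp_all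
  moreover have "0 < (1 - a) * (1 - p)" using assms by simp
  then have "a + p < 1 + a * p" by (simp add: algebra_simps)
  ultimately show "0 < trans_prob a p 0 1" "trans_prob a p 0 1 < 1"
      "0 < trans_prob a p 1 1" "trans_prob a p 1 1 < 1"
    unfolding trans_prob_def using assms by (auto simp: field_simps not_less; linarith)+
qed

section \<open>From the copula chain on its own probability space to the path law\<close>

context
  fixes M :: "'w measure" and X :: "nat \<Rightarrow> 'w \<Rightarrow> nat" and a p :: real
  assumes chain: "copula_bernoulli_chain M X a p"
    and a: "0 < a" "a < 1" and p: "0 < p" "p < 1"
begin

interpretation prob_space M
  using chain by (simp add: copula_bernoulli_chain_def)

lemma measurable_chain [measurable]: "X t \<in> measurable M (count_space UNIV)"
  using chain by (simp add: copula_bernoulli_chain_def)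

lemma prob_chain_le: "prob {\<omega>\<in>space M. real (X t \<omega>) \<le> x} = bern_cdf p x"
  using chain by (simp add: copula_bernoulli_chain_def)

lemma prob_chain_state: "prob {\<omega>\<in>space M. X t \<omega> = i} = pmf (bernoulli_nat_pmf p) i"
proof -
  have 0: "prob {\<omega>\<in>space M. X t \<omega> = 0} = 1 - p"
    using prob_chain_le[of t 0] by (simp add: bern_cdf_def)
  have le1: "prob {\<omega>\<in>space M. X t \<omega> \<le> 1} = 1"
    using prob_chain_le[of t 1] by (simp add: bern_cdf_def)
  have "{\<omega>\<in>space M. X t \<omega> \<le> 1} = {\<omega>\<in>space M. X t \<omega> = 0} \<union> {\<omega>\<in>space M. X t \<omega> = 1}"
    by auto
  then have "prob {\<omega>\<in>space M. X t \<omega> \<le> 1} = prob {\<omega>\<in>space M. X t \<omega> = 0} + prob {\<omega>\<in>space M. X t \<omega> = 1}"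
    by (simp only:) (intro finite_measure_Union, auto)
  with 0 le1 have 1: "prob {\<omega>\<in>space M. X t \<omega> = 1} = p" by simp
  have "prob {\<omega>\<in>space M. X t \<omega> = i} = 0" if "i > 1"
  proof -
    have "prob {\<omega>\<in>space M. X t \<omega> \<le> 1} + prob {\<omega>\<in>space M. X t \<omega> = i} =
        prob ({\<omega>\<in>space M. X t \<omega> \<le> 1} \<union> {\<omega>\<in>space M. X t \<omega> = i})"
      using that by (intro finite_measure_Union[symmetric]) auto
    also have "\<dots> \<le> 1" by simp
    finally show ?thesis using le1 by (simp add: measure_le_0_iff)
  qed
  with 0 1 show ?thesis using p by (simp add: pmf_bernoulli_nat)
qed

lemma AE_chain: "AE \<omega> in M. X t \<omega> = 0 \<or> X t \<omega> = 1"
proof -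
  have "prob {\<omega>\<in>space M. X t \<omega> = 0 \<or> X t \<omega> = 1} = 1"
  proof -
    have "{\<omega>\<in>space M. X t \<omega> = 0 \<or> X t \<omega> = 1} = {\<omega>\<in>space M. real (X t \<omega>) \<le> 1}" by auto
    then show ?thesis using prob_chain_le[of t 1] by (simp add: bern_cdf_def)
  qed
  then show ?thesis by (subst (asm) prob_eq_1) simp_all
qed

text \<open>The joint law of two consecutive states has four unknown entries. The copula at (F(0),
  F(0)) gives the entry for (0, 0), and the marginals determine the other three.\<close>

lemma prob_chain_transition:
  "prob {\<omega>\<in>space M. X t \<omega> = i \<and> X (Suc t) \<omega> = j} =
    pmf (bernoulli_nat_pmf p) i *
    pmf (bernoulli_nat_pmf (if i = 0 then trans_prob a p 0 1 else trans_prob a p 1 1)) j"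
proof -
  define J where "J i j = prob {\<omega>\<in>space M. X t \<omega> = i \<and> X (Suc t) \<omega> = j}" for i j
  have row: "J i 0 + J i 1 = prob {\<omega>\<in>space M. X t \<omega> = i}" for i
  proof -
    have "J i 0 + J i 1 = prob ({\<omega>\<in>space M. X t \<omega> = i \<and> X (Suc t) \<omega> = 0}
        \<union> {\<omega>\<in>space M. X t \<omega> = i \<and> X (Suc t) \<omega> = 1})"
      unfolding J_def by (intro finite_measure_Union[symmetric]) auto
    also have "\<dots> = prob {\<omega>\<in>space M. X t \<omega> = i}"
      using AE_chain[of "Suc t"] by (intro finite_measure_eq_AE) auto
    finally show ?thesis .
  qed
  have col: "J 0 j + J 1 j = prob {\<omega>\<in>space M. X (Suc t) \<omega> = j}" for j
  proof -
    have "J 0 j + J 1 j = prob ({\<omega>\<in>space M. X t \<omega> = 0 \<and> X (Suc t) \<omega> = j}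
        \<union> {\<omega>\<in>space M. X t \<omega> = 1 \<and> X (Suc t) \<omega> = j})"
      unfolding J_def by (intro finite_measure_Union[symmetric]) auto
    also have "\<dots> = prob {\<omega>\<in>space M. X (Suc t) \<omega> = j}"
      using AE_chain[of t] by (intro finite_measure_eq_AE) auto
    finally show ?thesis .
  qed
  have "J 0 0 = prob {\<omega>\<in>space M. real (X t \<omega>) \<le> 0 \<and> real (X (Suc t) \<omega>) \<le> 0}"
    by (simp add: J_def)
  also have "\<dots> = copulaC a (bern_cdf p 0) (bern_cdf p 0)"
    using chain unfolding copula_bernoulli_chain_def by blast
  \<comment> \<open>The maximum of 1 - 2p and 0 is the origin of the case distinction at p = 1/2 in
    the transition probabilities.\<close>
  finally have J00: "J 0 0 = a * (1 - p) + (1 - a) * max (1 - 2 * p) 0"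
    by (simp add: copulaC_def bern_cdf_def)
  have J: "J 0 1 = (1 - p) - J 0 0" "J 1 0 = (1 - p) - J 0 0" "J 1 1 = p - J 1 0"
    using row[of 0] col[of 0] row[of 1] p by (simp_all add: prob_chain_state pmf_bernoulli_nat)
  have Jzero: "J i j = 0" if "i > 1 \<or> j > 1"
  proof -
    have "J i j \<le> prob {\<omega>\<in>space M. X t \<omega> = i}" "J i j \<le> prob {\<omega>\<in>space M. X (Suc t) \<omega> = j}"
      unfolding J_def by (intro finite_measure_mono; auto)+
    with that have "J i j \<le> 0" using p by (auto simp: prob_chain_state pmf_bernoulli_nat split: if_splits)
    then show ?thesis unfolding J_def by (simp add: measure_le_0_iff)
  qed
  define \<alpha> \<beta> where "\<alpha> = trans_prob a p 0 1" and "\<beta> = trans_prob a p 1 1"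
  have \<alpha>\<beta>: "0 \<le> \<alpha>" "\<alpha> \<le> 1" "0 \<le> \<beta>" "\<beta> \<le> 1"
    using trans_prob_bounds[OF a p] by (simp_all add: \<alpha>_def \<beta>_def)
  have "J 0 1 = (1 - p) * \<alpha>"
    using p unfolding J(1) J00 \<alpha>_def
    by (cases "p < 1 / 2") (simp_all add: trans_prob_def max_def, simp_all add: algebra_simps)
  moreover have "J 1 1 = p * \<beta>"
    using p unfolding J J00 \<beta>_def
    by (cases "p < 1 / 2") (simp_all add: trans_prob_def max_def, simp_all add: algebra_simps)
  ultimately have J': "J 0 1 = (1 - p) * \<alpha>" "J 0 0 = (1 - p) * (1 - \<alpha>)"
      "J 1 1 = p * \<beta>" "J 1 0 = p * (1 - \<beta>)"
    using J by (simp_all add: algebra_simps)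
  have "J i j = pmf (bernoulli_nat_pmf p) i * pmf (bernoulli_nat_pmf (if i = 0 then \<alpha> else \<beta>)) j"
  proof (cases "i > 1 \<or> j > 1")
    case True
    then show ?thesis using p \<alpha>\<beta> by (auto simp: Jzero pmf_bernoulli_nat)
  next
    case False
    then have "i = 0 \<or> i = 1" "j = 0 \<or> j = 1" by linarith+
    then show ?thesis using p \<alpha>\<beta> J' by (elim disjE) (simp_all add: pmf_bernoulli_nat)
  qed
  then show ?thesis by (simp add: J_def \<alpha>_def \<beta>_def)
qed

lemma prob_chain_path:
  "prob {\<omega>\<in>space M. \<forall>t\<le>n. X t \<omega> = xs t} =
    pmf (path_pmf p (trans_prob a p 0 1) (trans_prob a p 1 1) n) (map xs [0..<Suc n])"
proof (induction n)
  case 0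
  show ?case using prob_chain_state[of 0 "xs 0"] pmf_path_0 by simp
next
  case (Suc n)
  let ?\<alpha> = "trans_prob a p 0 1" and ?\<beta> = "trans_prob a p 1 1"
  let ?m = "prob {\<omega>\<in>space M. \<forall>t\<le>n. X t \<omega> = xs t}"
  let ?m' = "prob {\<omega>\<in>space M. \<forall>t\<le>Suc n. X t \<omega> = xs t}"
  let ?k = "pmf (bernoulli_nat_pmf (if xs n = 0 then ?\<alpha> else ?\<beta>)) (xs (Suc n))"
  have rhs: "pmf (path_pmf p ?\<alpha> ?\<beta> (Suc n)) (map xs [0..<Suc (Suc n)]) = ?m * ?k"
    using pmf_path_Suc[of p ?\<alpha> ?\<beta> n "map xs [0..<Suc n]" "xs (Suc n)"] Suc by simp
  have markov: "?m' * prob {\<omega>\<in>space M. X n \<omega> = xs n} =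
      ?m * prob {\<omega>\<in>space M. X n \<omega> = xs n \<and> X (Suc n) \<omega> = xs (Suc n)}"
    using chain unfolding copula_bernoulli_chain_def by blast
  \<comment> \<open>The Markov property is given in product form, so it determines the longer path
    probability only when the current state has positive probability; otherwise both path
    probabilities vanish.\<close>
  have "?m' = ?m * ?k"
  proof (cases "prob {\<omega>\<in>space M. X n \<omega> = xs n} = 0")
    case True
    have "?m \<le> prob {\<omega>\<in>space M. X n \<omega> = xs n}" by (intro finite_measure_mono) auto
    moreover have "?m' \<le> prob {\<omega>\<in>space M. X n \<omega> = xs n}" by (intro finite_measure_mono) auto
    ultimately show ?thesis using True by (simp add: measure_le_0_iff)
  next
    case False
    with markov show ?thesis by (simp add: prob_chain_transition prob_chain_state)
  qed
  with rhs show ?case by (simp only:)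
qed

lemma sample_eq_iff:
  "sample X n \<omega> = xs \<longleftrightarrow> length xs = Suc n \<and> (\<forall>t\<le>n. X t \<omega> = xs ! t)"
  by (auto simp: sample_def list_eq_iff_nth_eq less_Suc_eq_le simp del: upt_Suc)

lemma vimage_sample:
  "sample X n -` {xs} \<inter> A = {\<omega>\<in>A. length xs = Suc n \<and> (\<forall>t\<le>n. X t \<omega> = xs ! t)}"
  unfolding sample_eq_iff[symmetric] by auto

lemma measurable_sample [measurable]: "sample X n \<in> measurable M (count_space UNIV)"
  unfolding measurable_count_space_eq_countable[OF countableI_type]
proof (intro conjI ballI)
  fix xs :: "nat list"
  have "{\<omega>\<in>space M. length xs = Suc n \<and> (\<forall>t\<le>n. X t \<omega> = xs ! t)} =
      {\<omega>\<in>space M. length xs = Suc n \<and> (\<forall>t\<in>{..n}. X t \<omega> = xs ! t)}"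
    by auto
  also have "\<dots> \<in> sets M" by measurable
  finally show "sample X n -` {xs} \<inter> space M \<in> sets M" by (simp only: vimage_sample)
qed simp

text \<open>Lists of naturals are countable, so agreement on singletons suffices. Every probability
  or expectation of a function of the sample may then be computed under
  \<open>path_pmf\<close>.\<close>

lemma distr_sample:
  "distr M (count_space UNIV) (sample X n) =
    path_pmf p (trans_prob a p 0 1) (trans_prob a p 1 1) n" (is "?D = measure_pmf ?P")
proof (rule measure_eqI_countable)
  fix xs :: "nat list"
  interpret D: prob_space ?D by (rule prob_space_distr) measurable
  have "measure ?D {xs} = pmf ?P xs"
  proof (cases "length xs = Suc n")
    case True
    then have xs: "xs = map (\<lambda>t. xs ! t) [0..<Suc n]" by (simp add: map_nth del: upt_Suc flip: True)
    have "sample X n -` {xs} \<inter> space M = {\<omega>\<in>space M. \<forall>t\<le>n. X t \<omega> = xs ! t}"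
      using True by (simp add: vimage_sample)
    then have "measure ?D {xs} = prob {\<omega>\<in>space M. \<forall>t\<le>n. X t \<omega> = xs ! t}"
      by (simp add: measure_distr)
    also have "\<dots> = pmf ?P xs" by (subst (2) xs) (rule prob_chain_path)
    finally show ?thesis .
  next
    case False
    then have "sample X n -` {xs} \<inter> space M = {}" by (simp add: vimage_sample)
    then have "measure ?D {xs} = 0" by (simp add: measure_distr)
    moreover have "pmf ?P xs = 0" using False set_path_pmf by (auto simp: pmf_eq_0_set_pmf)
    ultimately show ?thesis by simp
  qed
  then show "emeasure ?D {xs} = emeasure ?P {xs}"
    by (simp add: D.emeasure_eq_measure emeasure_pmf_single)
qed (auto intro: countableI_type)

lemma prob_sample:
  "measure M {\<omega>\<in>space M. Q (sample X n \<omega>)} =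
    measure_pmf.prob (path_pmf p (trans_prob a p 0 1) (trans_prob a p 1 1) n) {xs. Q xs}"
  by (subst distr_sample[symmetric], subst measure_distr)
    (auto intro!: arg_cong[where f=prob])

lemma expectation_sample:
  fixes f :: "nat list \<Rightarrow> 'b::{banach, second_countable_topology}"
  shows "(\<integral>\<omega>. f (sample X n \<omega>) \<partial>M) =
    measure_pmf.expectation (path_pmf p (trans_prob a p 0 1) (trans_prob a p 1 1) n) f"
  by (subst distr_sample[symmetric], subst integral_distr) auto

end

section \<open>Limit theorems for transition counts\<close>

lemma trans_count_singleton [simp]: "trans_count [i] j k = 0"
  by (simp add: trans_count_def)

lemma trans_count_snoc:
  assumes "xs \<noteq> []"
  shows "trans_count (xs @ [j]) i k = trans_count xs i k + (if last xs = i \<and> j = k then 1 else 0)"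
proof -
  have fin: "finite {t. Suc t < length xs \<and> xs ! t = i \<and> xs ! Suc t = k}"
    by (rule finite_subset[of _ "{..<length xs}"]) auto
  have "{t. Suc t < length (xs @ [j]) \<and> (xs @ [j]) ! t = i \<and> (xs @ [j]) ! Suc t = k} =
      {t. Suc t < length xs \<and> xs ! t = i \<and> xs ! Suc t = k} \<union>
      (if last xs = i \<and> j = k then {length xs - 1} else {})" (is "?L = ?A \<union> ?B")
  proof (rule set_eqI)
    fix t
    consider "Suc t < length xs" | "Suc t = length xs" | "Suc t > length xs" by linarith
    then show "t \<in> ?L \<longleftrightarrow> t \<in> ?A \<union> ?B"
    proof cases
      case 2
      then have "t = length xs - 1" by simp
      with assms show ?thesis using 2 by (auto simp: nth_append last_conv_nth)
    qed (use assms in \<open>auto simp: nth_append\<close>)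
  qed
  moreover have "?A \<inter> ?B = {}" by auto
  ultimately show ?thesis
    unfolding trans_count_def using fin by (simp only:) (subst card_Un_disjoint, auto)
qed

text \<open>Visits are counted through departures, hence at times 0 to n - 1 only; the final state
  of the path is left out.\<close>

definition visits :: "nat list \<Rightarrow> nat \<Rightarrow> real" where
  "visits xs i = real (trans_count xs i 0) + real (trans_count xs i 1)"

definition deviation :: "real \<Rightarrow> nat list \<Rightarrow> nat \<Rightarrow> real" where
  "deviation \<theta> xs i = real (trans_count xs i 1) - \<theta> * visits xs i"

text \<open>For a state without departures the quotient is 0 by convention; such paths have
  vanishing probability.\<close>

definition ratio :: "nat list \<Rightarrow> nat \<Rightarrow> real" where
  "ratio xs i = real (trans_count xs i 1) / visits xs i"

definition p_hat :: "nat list \<Rightarrow> real" where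
  "p_hat xs = ratio xs 0 / (1 - ratio xs 1 + ratio xs 0)"

lemma visits_singleton [simp]: "visits [j] i = 0"
  by (simp add: visits_def)

lemma deviation_singleton [simp]: "deviation \<theta> [j] i = 0"
  by (simp add: deviation_def)

lemma visits_snoc:
  "xs \<noteq> [] \<Longrightarrow> j \<in> {0, 1} \<Longrightarrow> visits (xs @ [j]) i = visits xs i + (if last xs = i then 1 else 0)"
  by (auto simp: visits_def trans_count_snoc)

lemma deviation_snoc:
  "xs \<noteq> [] \<Longrightarrow> j \<in> {0, 1} \<Longrightarrow>
    deviation \<theta> (xs @ [j]) i = deviation \<theta> xs i + (if last xs = i then real j - \<theta> else 0)"
  by (auto simp: deviation_def visits_snoc trans_count_snoc algebra_simps)

lemma visits_nonneg: "visits xs i \<ge> 0"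
  by (simp add: visits_def)

lemma visits_sum:
  "xs \<noteq> [] \<Longrightarrow> set xs \<subseteq> {0, 1} \<Longrightarrow> visits xs 0 + visits xs 1 = real (length xs) - 1"
proof (induction xs rule: rev_induct)
  case (snoc j xs)
  show ?case
  proof (cases "xs = []")
    case False
    then have "last xs \<in> {0, 1}" using snoc.prems last_in_set by fastforce
    then show ?thesis using snoc False by (auto simp: visits_snoc)
  qed simp
qed simp

text \<open>The two counts record the times 1 to n at which the chain is in state 1, while
  \<open>visits\<close> records the times 0 to n - 1, so only the two ends of the path survive in
  the difference.\<close>

lemma entries_minus_exits:
  "xs \<noteq> [] \<Longrightarrow> set xs \<subseteq> {0, 1} \<Longrightarrow>
    real (trans_count xs 0 1) + real (trans_count xs 1 1) - visits xs 1 = real (last xs) - real (hd xs)"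
proof (induction xs rule: rev_induct)
  case (snoc j xs)
  show ?case
  proof (cases "xs = []")
    case False
    then have "last xs \<in> {0, 1}" using snoc.prems last_in_set by fastforce
    then show ?thesis using snoc False by (auto simp: visits_snoc trans_count_snoc)
  qed simp
qed simp

definition "\<pi>0 \<alpha> \<beta> = (1 - \<beta>) / (1 - \<beta> + \<alpha> :: real)"

definition "\<pi>1 \<alpha> \<beta> = \<alpha> / (1 - \<beta> + \<alpha> :: real)"

text \<open>The stationary probability \<open>\<pi>1\<close> has partial derivatives \<open>(1 - \<beta>) \<rho>\<close> in \<open>\<alpha>\<close> and \<open>\<alpha> \<rho>\<close> in \<open>\<beta>\<close>.\<close>
definition "\<rho> \<alpha> \<beta> = 1 / (1 - \<beta> + \<alpha> :: real)\<^sup>2"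

text \<open>The constants let both halves of the parameter space be treated at once: (c, d) = (0, 1)
  gives the error in a when a = \<beta>, and (-1, 0) when a = 1 - \<alpha>.\<close>

definition scaled_error :: "real \<Rightarrow> real \<Rightarrow> real \<Rightarrow> real \<Rightarrow> nat \<Rightarrow> nat list \<Rightarrow> real \<times> real" where
  "scaled_error \<alpha> \<beta> c d n xs =
    sqrt (Suc n) *\<^sub>R (c * (ratio xs 0 - \<alpha>) + d * (ratio xs 1 - \<beta>), p_hat xs - \<pi>1 \<alpha> \<beta>)"

context
  fixes p \<alpha> \<beta> :: real
  assumes \<alpha>: "0 < \<alpha>" "\<alpha> < 1" and \<beta>: "0 < \<beta>" "\<beta> < 1"
begin

abbreviation (input) "walk \<equiv> path_pmf p \<alpha> \<beta>"

section \<open>Second moments and the law of large numbers\<close>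

lemma path_support:
  assumes "xs \<in> set_pmf (walk n)"
  shows "xs \<noteq> []" "length xs = Suc n" "set xs \<subseteq> {0, 1}" "last xs \<in> {0, 1}" "hd xs \<in> {0, 1}"
    "visits xs 0 + visits xs 1 = n"
proof -
  show *: "length xs = Suc n" "set xs \<subseteq> {0, 1}" using set_path_pmf[OF assms] by simp_all
  then show ne: "xs \<noteq> []" by auto
  show "last xs \<in> {0, 1}" "hd xs \<in> {0, 1}" using * last_in_set[OF ne] hd_in_set[OF ne] by blast+
  show "visits xs 0 + visits xs 1 = n" using visits_sum[OF ne *(2)] *(1) by simp
qed

text \<open>The increment is centred given the past, so the cross term cancels. A visit adds the
  variance \<open>\<theta> * (1 - \<theta>)\<close>, at most 1, and any other step adds
  nothing.\<close>

lemma deviation_second_moment: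
  assumes "i = 0 \<and> \<theta> = \<alpha> \<or> i = 1 \<and> \<theta> = \<beta>"
  shows "measure_pmf.expectation (walk n) (\<lambda>xs. (deviation \<theta> xs i)\<^sup>2) \<le> n"
proof (induction n)
  case 0
  show ?case by (simp add: integral_map_pmf)
next
  case (Suc n)
  let ?\<theta> = "\<lambda>xs::nat list. if last xs = 0 then \<alpha> else \<beta>"
  have \<theta>: "0 < \<theta>" "\<theta> < 1" using assms \<alpha> \<beta> by auto
  have "measure_pmf.expectation (walk (Suc n)) (\<lambda>xs. (deviation \<theta> xs i)\<^sup>2) =
     measure_pmf.expectation (walk n) (\<lambda>xs. (1 - ?\<theta> xs) *\<^sub>R (deviation \<theta> (xs @ [0]) i)\<^sup>2
        + ?\<theta> xs *\<^sub>R (deviation \<theta> (xs @ [1]) i)\<^sup>2)"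
    using \<alpha> \<beta> by (intro expectation_path_Suc) simp_all
  also have "\<dots> \<le> measure_pmf.expectation (walk n) (\<lambda>xs. (deviation \<theta> xs i)\<^sup>2 + 1)"
  proof (rule integral_mono_AE)
    show "AE xs in walk n. (1 - ?\<theta> xs) *\<^sub>R (deviation \<theta> (xs @ [0]) i)\<^sup>2
        + ?\<theta> xs *\<^sub>R (deviation \<theta> (xs @ [1]) i)\<^sup>2 \<le> (deviation \<theta> xs i)\<^sup>2 + 1"
      unfolding AE_measure_pmf_iff
    proof
      fix xs assume "xs \<in> set_pmf (walk n)"
      note xs = path_support[OF this]
      define D where "D = deviation \<theta> xs i"
      show "(1 - ?\<theta> xs) *\<^sub>R (deviation \<theta> (xs @ [0]) i)\<^sup>2
        + ?\<theta> xs *\<^sub>R (deviation \<theta> (xs @ [1]) i)\<^sup>2 \<le> (deviation \<theta> xs i)\<^sup>2 + 1"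
      proof (cases "last xs = i")
        case True
        then have "?\<theta> xs = \<theta>" using assms by auto
        moreover have "(1 - \<theta>) * (D - \<theta>)\<^sup>2 + \<theta> * (D + (1 - \<theta>))\<^sup>2 = D\<^sup>2 + \<theta> * (1 - \<theta>)"
          by (simp add: power2_eq_square algebra_simps)
        moreover have "\<theta> * (1 - \<theta>) \<le> 1" using \<theta> by (intro mult_le_one) auto
        ultimately show ?thesis
          using True xs(1) by (simp add: deviation_snoc D_def)
      next
        case False
        then show ?thesis using xs(1) by (simp add: deviation_snoc algebra_simps)
      qed
    qed
  qed simp_all
  also have "\<dots> = measure_pmf.expectation (walk n) (\<lambda>xs. (deviation \<theta> xs i)\<^sup>2) + 1" by simp
  finally show ?case using Suc by simp
qed

lemma tight_deviation:
  assumes "i = 0 \<and> \<theta> = \<alpha> \<or> i = 1 \<and> \<theta> = \<beta>"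
  shows "tight_prob walk (\<lambda>n xs. deviation \<theta> xs i / sqrt n)"
proof (rule tight_prob_second_moment)
  fix n
  have "measure_pmf.expectation (walk n) (\<lambda>xs. (norm (deviation \<theta> xs i / sqrt n))\<^sup>2) =
      measure_pmf.expectation (walk n) (\<lambda>xs. (deviation \<theta> xs i)\<^sup>2) / n"
    by (simp add: power_divide)
  also have "\<dots> \<le> 1" using deviation_second_moment[OF assms, of n] by (simp add: divide_le_eq)
  finally show "measure_pmf.expectation (walk n) (\<lambda>xs. (norm (deviation \<theta> xs i / sqrt n))\<^sup>2) \<le> 1" .
qed simp

lemma deviation_negligible:
  assumes "i = 0 \<and> \<theta> = \<alpha> \<or> i = 1 \<and> \<theta> = \<beta>"
  shows "tendsto_prob walk (\<lambda>n xs. deviation \<theta> xs i / n) 0"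
proof -
  have "(\<lambda>n. 1 / sqrt (real n)) \<longlonglongrightarrow> 0" by real_asymp
  from tight_prob_mult_null[OF tight_deviation[OF assms] tendsto_prob_const[OF this]]
  show ?thesis by (simp flip: real_sqrt_mult)
qed

text \<open>Expressing the counts through the deviations D0, D1, the balance of entries and exits
  becomes the exact identity visits_1 (1 - \<beta> + \<alpha>) = n \<alpha> + D0 + D1 + hd - last.
  After division by n all but the first term on the right vanish in probability.\<close>

lemma visits_lln:
  "tendsto_prob walk (\<lambda>n xs. visits xs 1 / n) (\<alpha> / (1 - \<beta> + \<alpha>))"
  "tendsto_prob walk (\<lambda>n xs. visits xs 0 / n) ((1 - \<beta>) / (1 - \<beta> + \<alpha>))"
proof -
  have pos: "1 - \<beta> + \<alpha> > 0" using \<alpha> \<beta> by simp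
  have balance: "tendsto_prob walk (\<lambda>n xs. (real (hd xs) - real (last xs)) / n) 0"
  proof (rule tendsto_prob_bound, intro always_eventually allI ballI)
    fix n xs assume "xs \<in> set_pmf (walk n)"
    note xs = path_support[OF this]
    show "dist ((real (hd xs) - real (last xs)) / n) 0 \<le> 1 / real n"
      using xs(4,5) by auto
  qed real_asymp
  have "tendsto_prob walk (\<lambda>n xs. (\<alpha> + (deviation \<alpha> xs 0 / n + (deviation \<beta> xs 1 / n
          + (real (hd xs) - real (last xs)) / n))) / (1 - \<beta> + \<alpha>))
      ((\<alpha> + (0 + (0 + 0))) / (1 - \<beta> + \<alpha>))"
    using pos balance
    by (intro tendsto_prob_divide tendsto_prob_add tendsto_prob_const tendsto_const
        deviation_negligible) auto
  then have "tendsto_prob walk (\<lambda>n xs. visits xs 1 / n) ((\<alpha> + (0 + (0 + 0))) / (1 - \<beta> + \<alpha>))"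
  proof (rule tendsto_prob_cong_support)
    fix n :: nat and xs assume n: "n > 0" and "xs \<in> set_pmf (walk n)"
    note xs = path_support[OF this(2)]
    have "visits xs 1 * (1 - \<beta> + \<alpha>) =
        \<alpha> * n + deviation \<alpha> xs 0 + deviation \<beta> xs 1 + (real (hd xs) - real (last xs))"
      using entries_minus_exits[OF xs(1,3)] unfolding xs(6)[symmetric]
      by (simp add: deviation_def algebra_simps)
    then have "\<alpha> + (deviation \<alpha> xs 0 / n + (deviation \<beta> xs 1 / n
          + (real (hd xs) - real (last xs)) / n)) = visits xs 1 / n * (1 - \<beta> + \<alpha>)"
      using n by (simp add: field_simps)
    then show "(\<alpha> + (deviation \<alpha> xs 0 / n + (deviation \<beta> xs 1 / n
          + (real (hd xs) - real (last xs)) / n))) / (1 - \<beta> + \<alpha>) = visits xs 1 / n"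
      using pos by simp
  qed
  then show 1: "tendsto_prob walk (\<lambda>n xs. visits xs 1 / n) (\<alpha> / (1 - \<beta> + \<alpha>))" by simp
  have "tendsto_prob walk (\<lambda>n xs. 1 + (- 1) * (visits xs 1 / n)) (1 + (- 1) * (\<alpha> / (1 - \<beta> + \<alpha>)))"
    by (intro tendsto_prob_add tendsto_prob_mult tendsto_prob_const tendsto_const 1)
  moreover have "1 + (- 1) * (\<alpha> / (1 - \<beta> + \<alpha>)) = (1 - \<beta>) / (1 - \<beta> + \<alpha>)"
    using pos by (simp add: field_simps)
  ultimately show "tendsto_prob walk (\<lambda>n xs. visits xs 0 / n) ((1 - \<beta>) / (1 - \<beta> + \<alpha>))"
    by (auto elim!: tendsto_prob_cong_support)
       (auto dest!: path_support(6) simp: field_simps)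
qed

section \<open>Joint central limit theorem for the deviations\<close>

definition "step_factor \<theta> t =
  exp (t\<^sup>2 * (\<theta> * (1 - \<theta>)) / 2) *\<^sub>R ((1 - \<theta>) *\<^sub>R cis (- t * \<theta>) + \<theta> *\<^sub>R cis (t * (1 - \<theta>)))"

text \<open>The real exponent is half the accumulated conditional variance of the phase;
  \<open>v\<close> is the frequency for state 0 and \<open>u\<close> the one for state 1. A step
  from a given state multiplies the conditional mean by the \<open>step_factor\<close> of that
  state, which is close to 1.\<close>

definition "tilted u v xs = exp (v\<^sup>2 * (\<alpha> * (1 - \<alpha>)) / 2 * visits xs 0 + u\<^sup>2 * (\<beta> * (1 - \<beta>)) / 2 * visits xs 1)
  *\<^sub>R cis (v * deviation \<alpha> xs 0 + u * deviation \<beta> xs 1)"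

lemma tilted_step:
  assumes "xs \<in> set_pmf (walk n)"
  shows "(1 - (if last xs = 0 then \<alpha> else \<beta>)) *\<^sub>R tilted u v (xs @ [0])
        + (if last xs = 0 then \<alpha> else \<beta>) *\<^sub>R tilted u v (xs @ [1])
      = tilted u v xs * (if last xs = 0 then step_factor \<alpha> v else step_factor \<beta> u)"
proof -
  note xs = path_support[OF assms]
  let ?w = "\<lambda>\<theta> t j. exp (t\<^sup>2 * (\<theta> * (1 - \<theta>)) / 2) *\<^sub>R cis (t * (real j - \<theta>))"
  have combine: "exp (x + y) *\<^sub>R cis (x' + y') = (exp x *\<^sub>R cis x') * (exp y *\<^sub>R cis y')" for x y x' y'
    by (simp add: exp_add cis_mult)
  have factor: "(1 - \<theta>) *\<^sub>R (z * ?w \<theta> t 0) + \<theta> *\<^sub>R (z * ?w \<theta> t 1) = z * step_factor \<theta> t" for \<theta> t z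
    by (simp add: step_factor_def scaleR_conv_of_real algebra_simps)
  show ?thesis
  proof (cases "last xs = 0")
    case True
    have "tilted u v (xs @ [j]) = tilted u v xs * ?w \<alpha> v j" if "j \<in> {0, 1}" for j
      unfolding tilted_def combine[symmetric] visits_snoc[OF xs(1) that] deviation_snoc[OF xs(1) that]
      using True by (simp add: field_simps)
    then have "tilted u v (xs @ [0]) = tilted u v xs * ?w \<alpha> v 0"
      "tilted u v (xs @ [1]) = tilted u v xs * ?w \<alpha> v 1" by blast+
    then show ?thesis using True factor[of \<alpha> "tilted u v xs" v] by (simp only: if_True simp_thms)
  next
    case False
    then have last: "last xs = 1" using xs(4) by simp
    have "tilted u v (xs @ [j]) = tilted u v xs * ?w \<beta> u j" if "j \<in> {0, 1}" for j
      unfolding tilted_def combine[symmetric] visits_snoc[OF xs(1) that] deviation_snoc[OF xs(1) that]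
      using last by (simp add: field_simps)
    then have "tilted u v (xs @ [0]) = tilted u v xs * ?w \<beta> u 0"
      "tilted u v (xs @ [1]) = tilted u v xs * ?w \<beta> u 1" by blast+
    then show ?thesis using False factor[of \<beta> "tilted u v xs" u] by (simp only: if_False)
  qed
qed

text \<open>The difference telescopes over the steps, and the largest of the step bounds is used for
  all of them. For frequencies of order 1 / sqrt n the exponent c n stays constant, so it remains to
  show that n times \<delta> vanishes.\<close>

lemma tilted_expectation:
  fixes u v :: real
  defines "c \<equiv> v\<^sup>2 * (\<alpha> * (1 - \<alpha>)) / 2 + u\<^sup>2 * (\<beta> * (1 - \<beta>)) / 2"
  defines "\<delta> \<equiv> norm (step_factor \<alpha> v - 1) + norm (step_factor \<beta> u - 1)"
  shows "norm (measure_pmf.expectation (walk n) (tilted u v) - 1) \<le> n * (exp (c * n) * \<delta>)"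
proof -
  have c1: "0 \<le> v\<^sup>2 * (\<alpha> * (1 - \<alpha>)) / 2" "0 \<le> u\<^sup>2 * (\<beta> * (1 - \<beta>)) / 2" using \<alpha> \<beta> by simp_all
  have \<delta>: "0 \<le> \<delta>" by (simp add: \<delta>_def)
  have step: "norm (measure_pmf.expectation (walk (Suc k)) (tilted u v) - measure_pmf.expectation (walk k) (tilted u v))
      \<le> exp (c * k) * \<delta>" for k
  proof -
    let ?g = "\<lambda>xs::nat list. if last xs = 0 then step_factor \<alpha> v else step_factor \<beta> u"
    have "measure_pmf.expectation (walk (Suc k)) (tilted u v) =
       measure_pmf.expectation (walk k) (\<lambda>xs. (1 - (if last xs = 0 then \<alpha> else \<beta>)) *\<^sub>R tilted u v (xs @ [0])
        + (if last xs = 0 then \<alpha> else \<beta>) *\<^sub>R tilted u v (xs @ [1]))"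
      using \<alpha> \<beta> by (intro expectation_path_Suc) simp_all
    also have "\<dots> = measure_pmf.expectation (walk k) (\<lambda>xs. tilted u v xs * ?g xs)"
    proof (rule integral_cong_AE)
      show "AE xs in walk k. (1 - (if last xs = 0 then \<alpha> else \<beta>)) *\<^sub>R tilted u v (xs @ [0])
          + (if last xs = 0 then \<alpha> else \<beta>) *\<^sub>R tilted u v (xs @ [1]) = tilted u v xs * ?g xs"
        unfolding AE_measure_pmf_iff by (intro ballI) (rule tilted_step)
    qed simp_all
    finally have "measure_pmf.expectation (walk (Suc k)) (tilted u v) - measure_pmf.expectation (walk k) (tilted u v)
        = measure_pmf.expectation (walk k) (\<lambda>xs. tilted u v xs * (?g xs - 1))"
      by (simp add: right_diff_distrib)
    also have "norm \<dots> \<le> measure_pmf.expectation (walk k) (\<lambda>xs. norm (tilted u v xs * (?g xs - 1)))"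
      by (rule integral_norm_bound)
    also have "\<dots> \<le> measure_pmf.expectation (walk k) (\<lambda>xs. exp (c * k) * \<delta>)"
    proof (rule integral_mono_AE)
      show "AE xs in walk k. norm (tilted u v xs * (?g xs - 1)) \<le> exp (c * k) * \<delta>"
        unfolding AE_measure_pmf_iff
      proof
        fix xs assume "xs \<in> set_pmf (walk k)"
        note xs = path_support[OF this]
        have le: "visits xs 0 \<le> k" "visits xs 1 \<le> k"
          using xs(6) visits_nonneg[of xs 0] visits_nonneg[of xs 1] by linarith+
        \<comment> \<open>Both numbers of visits are bounded by k separately, which is crude but
          costs only a constant factor.\<close>
        have "v\<^sup>2 * (\<alpha> * (1 - \<alpha>)) / 2 * visits xs 0 + u\<^sup>2 * (\<beta> * (1 - \<beta>)) / 2 * visits xs 1 \<le> c * k"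
          unfolding c_def distrib_right by (intro add_mono mult_left_mono le c1)
        then have "norm (tilted u v xs) \<le> exp (c * k)" by (simp add: tilted_def)
        moreover have "norm (?g xs - 1) \<le> \<delta>" by (simp add: \<delta>_def)
        ultimately show "norm (tilted u v xs * (?g xs - 1)) \<le> exp (c * k) * \<delta>"
          unfolding norm_mult by (intro mult_mono) simp_all
      qed
    qed simp_all
    finally show ?thesis by simp
  qed
  have c: "0 \<le> c" using c1 by (simp add: c_def)
  show ?thesis
  proof (induction n)
    case 0
    show ?case by (simp add: integral_map_pmf tilted_def)
  next
    case (Suc n)
    have mono: "exp (c * n) * \<delta> \<le> exp (c * Suc n) * \<delta>"
      using c \<delta> by (intro mult_right_mono) (auto intro!: mult_left_mono)
    have "norm (measure_pmf.expectation (walk (Suc n)) (tilted u v) - 1) \<le>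
        norm (measure_pmf.expectation (walk (Suc n)) (tilted u v) - measure_pmf.expectation (walk n) (tilted u v))
        + norm (measure_pmf.expectation (walk n) (tilted u v) - 1)"
      using norm_triangle_ineq[of "measure_pmf.expectation (walk (Suc n)) (tilted u v) - measure_pmf.expectation (walk n) (tilted u v)"
          "measure_pmf.expectation (walk n) (tilted u v) - 1"] by simp
    also have "\<dots> \<le> exp (c * n) * \<delta> + n * (exp (c * n) * \<delta>)"
      by (intro add_mono step Suc.IH)
    also have "\<dots> = Suc n * (exp (c * n) * \<delta>)" by (simp add: algebra_simps)
    also have "\<dots> \<le> Suc n * (exp (c * Suc n) * \<delta>)" by (intro mult_left_mono mono) simp
    finally show ?case .
  qed
qed

text \<open>The exponential compensates the quadratic term of the characteristic function of a
  centred Bernoulli variable, leaving an error of third order in the frequency x. At x = t / sqrt n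
  it is of order n^(-3/2).\<close>

lemma step_factor_tendsto:
  assumes "0 \<le> \<theta>" "\<theta> \<le> 1"
  shows "(\<lambda>n. real n * norm (step_factor \<theta> (t / sqrt n) - 1)) \<longlonglongrightarrow> 0"
proof -
  define s where "s = \<theta> * (1 - \<theta>)"
  have cis_approx: "norm (cis x - (1 + \<i> * x - x\<^sup>2 / 2)) \<le> \<bar>x\<bar> ^ 3" for x :: real
  proof -
    have "norm (cis x - (1 + \<i> * x - x\<^sup>2 / 2)) \<le> \<bar>x\<bar> ^ 3 / 6"
      using iexp_approx1[of x 2]
      by (simp add: cis_conv_exp numeral_eq_Suc atMost_Suc fact_numeral power_mult_distrib algebra_simps)
    then show ?thesis by (rule order_trans) simp
  qed
  have bound: "norm (step_factor \<theta> x - 1) \<le>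
      exp (x\<^sup>2 * s / 2) * \<bar>x\<bar> ^ 3 + \<bar>exp (x\<^sup>2 * s / 2) * (1 - x\<^sup>2 * s / 2) - 1\<bar>" for x
  proof -
    define A where "A y = cis y - (1 + \<i> * of_real y - (of_real y)\<^sup>2 / 2)" for y
    define E where "E = (1 - \<theta>) *\<^sub>R A (- x * \<theta>) + \<theta> *\<^sub>R A (x * (1 - \<theta>))"
    define W where "W = (1 - \<theta>) *\<^sub>R cis (- x * \<theta>) + \<theta> *\<^sub>R cis (x * (1 - \<theta>))"
    \<comment> \<open>Under the weights 1 - \<theta> and \<theta> the linear terms cancel because
      the variable is centred, and the quadratic terms add up to minus half its variance times
      x^2.\<close>
    have E: "W = E + of_real (1 - x\<^sup>2 * s / 2)"
      by (simp add: W_def E_def A_def complex_eq_iff s_def field_simps power2_eq_square)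
    have "step_factor \<theta> x = exp (x\<^sup>2 * s / 2) *\<^sub>R W"
      by (simp add: step_factor_def s_def W_def)
    then have "step_factor \<theta> x - 1 = exp (x\<^sup>2 * s / 2) *\<^sub>R E
        + of_real (exp (x\<^sup>2 * s / 2) * (1 - x\<^sup>2 * s / 2) - 1)"
      unfolding E by (simp add: scaleR_conv_of_real algebra_simps)
    then have "norm (step_factor \<theta> x - 1) \<le> norm (exp (x\<^sup>2 * s / 2) *\<^sub>R E)
        + norm (of_real (exp (x\<^sup>2 * s / 2) * (1 - x\<^sup>2 * s / 2) - 1) :: complex)"
      by (simp only: norm_triangle_ineq)
    then have 1: "norm (step_factor \<theta> x - 1) \<le> exp (x\<^sup>2 * s / 2) * norm E
        + \<bar>exp (x\<^sup>2 * s / 2) * (1 - x\<^sup>2 * s / 2) - 1\<bar>"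
      unfolding norm_of_real norm_scaleR by simp
    have A: "norm (A y) \<le> \<bar>y\<bar> ^ 3" for y
      using cis_approx[of y] by (simp add: A_def)
    have "norm E \<le> norm ((1 - \<theta>) *\<^sub>R A (- x * \<theta>)) + norm (\<theta> *\<^sub>R A (x * (1 - \<theta>)))"
      unfolding E_def by (rule norm_triangle_ineq)
    also have "\<dots> \<le> (1 - \<theta>) * \<bar>- x * \<theta>\<bar> ^ 3 + \<theta> * \<bar>x * (1 - \<theta>)\<bar> ^ 3"
      unfolding norm_scaleR using assms by (intro add_mono mult_mono A) simp_all
    also have "\<dots> \<le> (1 - \<theta>) * \<bar>x\<bar> ^ 3 + \<theta> * \<bar>x\<bar> ^ 3"
      using assms by (intro add_mono mult_left_mono power_mono)
        (simp_all add: abs_mult mult_left_le)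
    also have "\<dots> = \<bar>x\<bar> ^ 3" by (simp add: algebra_simps)
    finally have "exp (x\<^sup>2 * s / 2) * norm E \<le> exp (x\<^sup>2 * s / 2) * \<bar>x\<bar> ^ 3"
      by (intro mult_left_mono) simp_all
    with 1 show ?thesis by linarith
  qed
  have lim1: "(\<lambda>n. real n * (exp (b / n) * (c ^ 3 / (sqrt n) ^ 3))) \<longlonglongrightarrow> 0" for b c :: real
    by real_asymp
  have lim2: "(\<lambda>n. real n * \<bar>exp (b / n) * (1 - b / n) - 1\<bar>) \<longlonglongrightarrow> 0" for b :: real
  proof -
    have "(\<lambda>n. real n * (exp (b / n) * (1 - b / n) - 1)) \<longlonglongrightarrow> 0" by real_asymp
    from tendsto_rabs_zero[OF this] show ?thesis by (simp add: abs_mult)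
  qed
  show ?thesis
  proof (rule Lim_null_comparison)
    show "\<forall>\<^sub>F n in sequentially. norm (real n * norm (step_factor \<theta> (t / sqrt n) - 1)) \<le>
        real n * (exp ((t\<^sup>2 * s / 2) / n) * (\<bar>t\<bar> ^ 3 / (sqrt n) ^ 3))
        + real n * \<bar>exp ((t\<^sup>2 * s / 2) / n) * (1 - (t\<^sup>2 * s / 2) / n) - 1\<bar>"
    proof (intro always_eventually allI)
      fix n :: nat
      have "(t / sqrt n)\<^sup>2 * s / 2 = (t\<^sup>2 * s / 2) / n" "\<bar>t / sqrt n\<bar> ^ 3 = \<bar>t\<bar> ^ 3 / (sqrt n) ^ 3"
        by (simp_all add: power_divide abs_divide)
      with bound[of "t / sqrt n"] have "norm (step_factor \<theta> (t / sqrt n) - 1) \<le>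
        exp ((t\<^sup>2 * s / 2) / n) * (\<bar>t\<bar> ^ 3 / (sqrt n) ^ 3)
        + \<bar>exp ((t\<^sup>2 * s / 2) / n) * (1 - (t\<^sup>2 * s / 2) / n) - 1\<bar>" by simp
      from mult_left_mono[OF this, of "real n"]
      show "norm (real n * norm (step_factor \<theta> (t / sqrt n) - 1)) \<le>
        real n * (exp ((t\<^sup>2 * s / 2) / n) * (\<bar>t\<bar> ^ 3 / (sqrt n) ^ 3))
        + real n * \<bar>exp ((t\<^sup>2 * s / 2) / n) * (1 - (t\<^sup>2 * s / 2) / n) - 1\<bar>"
        by (simp add: distrib_left)
    qed
    show "(\<lambda>n. real n * (exp ((t\<^sup>2 * s / 2) / n) * (\<bar>t\<bar> ^ 3 / (sqrt n) ^ 3))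
        + real n * \<bar>exp ((t\<^sup>2 * s / 2) / n) * (1 - (t\<^sup>2 * s / 2) / n) - 1\<bar>) \<longlonglongrightarrow> 0"
      using tendsto_add[OF lim1[of "t\<^sup>2 * s / 2" "\<bar>t\<bar>"] lim2[of "t\<^sup>2 * s / 2"]] by (simp only: add_0_left)
  qed
qed

text \<open>The compensated expectation E (R Z) tends to 1 and R tends to the constant r in mean, so
  r E Z tends to 1; dividing by r gives the Gaussian limit.\<close>

lemma deviation_characteristic_function:
  "(\<lambda>n. measure_pmf.expectation (walk n)
      (\<lambda>xs. cis (v * (deviation \<alpha> xs 0 / sqrt n) + u * (deviation \<beta> xs 1 / sqrt n))))
    \<longlonglongrightarrow> exp (- (v\<^sup>2 * (\<alpha> * (1 - \<alpha>)) * ((1 - \<beta>) / (1 - \<beta> + \<alpha>))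
          + u\<^sup>2 * (\<beta> * (1 - \<beta>)) * (\<alpha> / (1 - \<beta> + \<alpha>))) / 2)"
proof -
  define a where "a = v\<^sup>2 * (\<alpha> * (1 - \<alpha>)) / 2"
  define b where "b = u\<^sup>2 * (\<beta> * (1 - \<beta>)) / 2"
  have ab: "0 \<le> a" "0 \<le> b" using \<alpha> \<beta> by (simp_all add: a_def b_def)
  define R where "R n xs = exp (a * (visits xs 0 / real n) + b * (visits xs 1 / real n))" for n xs
  define r where "r = exp (a * ((1 - \<beta>) / (1 - \<beta> + \<alpha>)) + b * (\<alpha> / (1 - \<beta> + \<alpha>)))"
  define Z where "Z n xs = cis (v * (deviation \<alpha> xs 0 / sqrt (real n)) + u * (deviation \<beta> xs 1 / sqrt (real n)))" for n xs
  have tilted: "tilted (u / sqrt n) (v / sqrt n) = (\<lambda>xs. R n xs *\<^sub>R Z n xs)" for n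
    by (intro ext) (simp add: tilted_def R_def Z_def a_def b_def power_divide)
  have "(\<lambda>n. measure_pmf.expectation (walk n) (\<lambda>xs. R n xs *\<^sub>R Z n xs) - 1) \<longlonglongrightarrow> 0"
  proof (rule Lim_null_comparison)
    let ?\<delta> = "\<lambda>n. norm (step_factor \<alpha> (v / sqrt (real n)) - 1) + norm (step_factor \<beta> (u / sqrt (real n)) - 1)"
    show "\<forall>\<^sub>F n in sequentially. norm (measure_pmf.expectation (walk n) (\<lambda>xs. R n xs *\<^sub>R Z n xs) - 1)
        \<le> exp (a + b) * (real n * ?\<delta> n)"
      using eventually_gt_at_top[of 0]
    proof eventually_elim
      case (elim n)
      then have "((v / sqrt n)\<^sup>2 * (\<alpha> * (1 - \<alpha>)) / 2 + (u / sqrt n)\<^sup>2 * (\<beta> * (1 - \<beta>)) / 2) * n = a + b"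
        by (simp add: a_def b_def power_divide field_simps)
      with tilted_expectation[of n "u / sqrt n" "v / sqrt n"] show ?case
        by (simp add: tilted mult_ac)
    qed
    have "(\<lambda>n. exp (a + b) * (real n * ?\<delta> n)) \<longlonglongrightarrow> exp (a + b) * (0 + 0)"
      unfolding distrib_left[of "real _"] using \<alpha> \<beta>
      by (intro tendsto_mult tendsto_const tendsto_add step_factor_tendsto) auto
    then show "(\<lambda>n. exp (a + b) * (real n * ?\<delta> n)) \<longlonglongrightarrow> 0" by simp
  qed
  moreover have "(\<lambda>n. measure_pmf.expectation (walk n) (\<lambda>xs. r *\<^sub>R Z n xs)
      - measure_pmf.expectation (walk n) (\<lambda>xs. R n xs *\<^sub>R Z n xs)) \<longlonglongrightarrow> 0"
  proof (rule Lim_null_comparison)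
    have "tendsto_prob walk (\<lambda>n xs. a * (visits xs 0 / real n) + b * (visits xs 1 / real n))
       (a * ((1 - \<beta>) / (1 - \<beta> + \<alpha>)) + b * (\<alpha> / (1 - \<beta> + \<alpha>)))"
      by (intro tendsto_prob_add tendsto_prob_mult tendsto_prob_const tendsto_const visits_lln)
    then have "tendsto_prob walk (\<lambda>n xs. exp (a * (visits xs 0 / real n) + b * (visits xs 1 / real n))) r"
      unfolding r_def by (rule tendsto_prob_isCont) (intro continuous_intros)
    then have "tendsto_prob walk R r" by (simp only: R_def[abs_def])
    then show "(\<lambda>n. measure_pmf.expectation (walk n) (\<lambda>xs. norm (R n xs - r))) \<longlonglongrightarrow> 0"
    proof (rule tendsto_prob_bounded_L1)
      fix n xs assume "xs \<in> set_pmf (walk n)"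
      note xs = path_support[OF this]
      \<comment> \<open>Visit frequencies never exceed 1; the resulting uniform bound on R is what
        lifts convergence in probability to convergence in mean.\<close>
      have "visits xs 0 / real n \<le> 1" "visits xs 1 / real n \<le> 1"
        using xs(6) visits_nonneg[of xs 0] visits_nonneg[of xs 1] by (simp_all add: divide_le_eq)
      then have "a * (visits xs 0 / real n) + b * (visits xs 1 / real n) \<le> a * 1 + b * 1"
        using ab by (intro add_mono mult_left_mono)
      then show "norm (R n xs) \<le> exp (a + b)" by (simp add: R_def)
    qed
    show "\<forall>\<^sub>F n in sequentially. norm (measure_pmf.expectation (walk n) (\<lambda>xs. r *\<^sub>R Z n xs)
      - measure_pmf.expectation (walk n) (\<lambda>xs. R n xs *\<^sub>R Z n xs))
      \<le> measure_pmf.expectation (walk n) (\<lambda>xs. norm (R n xs - r))"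
    proof (intro always_eventually allI)
      fix n
      have "measure_pmf.expectation (walk n) (\<lambda>xs. r *\<^sub>R Z n xs) - measure_pmf.expectation (walk n) (\<lambda>xs. R n xs *\<^sub>R Z n xs)
          = measure_pmf.expectation (walk n) (\<lambda>xs. (r - R n xs) *\<^sub>R Z n xs)"
        by (simp add: scaleR_diff_left)
      also have "norm \<dots> \<le> measure_pmf.expectation (walk n) (\<lambda>xs. norm ((r - R n xs) *\<^sub>R Z n xs))"
        by (rule integral_norm_bound)
      finally show "norm (measure_pmf.expectation (walk n) (\<lambda>xs. r *\<^sub>R Z n xs)
        - measure_pmf.expectation (walk n) (\<lambda>xs. R n xs *\<^sub>R Z n xs))
        \<le> measure_pmf.expectation (walk n) (\<lambda>xs. norm (R n xs - r))"
        by (simp add: Z_def abs_minus_commute)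
    qed
  qed
  ultimately have "(\<lambda>n. r *\<^sub>R measure_pmf.expectation (walk n) (Z n) - 1) \<longlonglongrightarrow> 0"
    using tendsto_add by fastforce
  then have "(\<lambda>n. r *\<^sub>R measure_pmf.expectation (walk n) (Z n)) \<longlonglongrightarrow> 1"
    by (simp add: LIM_zero_iff)
  then have "(\<lambda>n. inverse r *\<^sub>R (r *\<^sub>R measure_pmf.expectation (walk n) (Z n))) \<longlonglongrightarrow> inverse r *\<^sub>R 1"
    by (intro tendsto_scaleR tendsto_const)
  moreover have "inverse r *\<^sub>R (r *\<^sub>R z) = z" for z :: complex by (simp add: r_def)
  moreover have "inverse r = exp (- (v\<^sup>2 * (\<alpha> * (1 - \<alpha>)) * ((1 - \<beta>) / (1 - \<beta> + \<alpha>))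
          + u\<^sup>2 * (\<beta> * (1 - \<beta>)) * (\<alpha> / (1 - \<beta> + \<alpha>))) / 2)"
  proof -
    have "a * A + b * B = (v\<^sup>2 * (\<alpha> * (1 - \<alpha>)) * A + u\<^sup>2 * (\<beta> * (1 - \<beta>)) * B) / 2" for A B
      by (simp add: a_def b_def add_divide_distrib)
    then show ?thesis unfolding r_def exp_minus[symmetric] by (simp only: minus_divide_left)
  qed
  ultimately have "(\<lambda>n. measure_pmf.expectation (walk n) (Z n)) \<longlonglongrightarrow>
      exp (- (v\<^sup>2 * (\<alpha> * (1 - \<alpha>)) * ((1 - \<beta>) / (1 - \<beta> + \<alpha>))
          + u\<^sup>2 * (\<beta> * (1 - \<beta>)) * (\<alpha> / (1 - \<beta> + \<alpha>))) / 2) *\<^sub>R 1"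
    by (simp only:)
  then show ?thesis unfolding Z_def[abs_def] scaleR_conv_of_real mult_1_right .
qed

lemma tight_deviations:
  "tight_prob walk (\<lambda>n xs. (deviation \<alpha> xs 0 / sqrt n, deviation \<beta> xs 1 / sqrt n))"
proof (rule tight_prob_second_moment)
  fix n
  have "measure_pmf.expectation (walk n) (\<lambda>xs. (norm (deviation \<alpha> xs 0 / sqrt n, deviation \<beta> xs 1 / sqrt n))\<^sup>2) =
      measure_pmf.expectation (walk n) (\<lambda>xs. (deviation \<alpha> xs 0)\<^sup>2) / n
      + measure_pmf.expectation (walk n) (\<lambda>xs. (deviation \<beta> xs 1)\<^sup>2) / n"
    by (simp add: norm_Pair power_divide)
  also have "\<dots> \<le> 1 + 1"
    using deviation_second_moment[of 0 \<alpha> n] deviation_second_moment[of 1 \<beta> n]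
    by (intro add_mono) (simp_all add: divide_le_eq)
  finally show "measure_pmf.expectation (walk n)
      (\<lambda>xs. (norm (deviation \<alpha> xs 0 / sqrt n, deviation \<beta> xs 1 / sqrt n))\<^sup>2) \<le> 2" by simp
qed simp

section \<open>From the deviations to the estimation errors\<close>

lemma stationary_pos: "(\<pi>0 \<alpha> \<beta>) > 0" "(\<pi>1 \<alpha> \<beta>) > 0"
  using \<alpha> \<beta> by (simp_all add: \<pi>0_def \<pi>1_def add_pos_pos)

text \<open>Once the state has been visited, ratio - \<theta> equals deviation / visits. The scaled
  error is thus the tight deviation / sqrt n times a factor that tends to 1 / \<pi>.\<close>

lemma ratio_error:
  assumes "i = 0 \<and> \<theta> = \<alpha> \<and> \<pi> = (\<pi>0 \<alpha> \<beta>) \<or> i = 1 \<and> \<theta> = \<beta> \<and> \<pi> = (\<pi>1 \<alpha> \<beta>)"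
  shows "tendsto_prob walk (\<lambda>n xs. ratio xs i) \<theta>"
    and "tendsto_prob walk (\<lambda>n xs. sqrt (Suc n) * (ratio xs i - \<theta>) - deviation \<theta> xs i / sqrt n / \<pi>) 0"
proof -
  have \<theta>: "i = 0 \<and> \<theta> = \<alpha> \<or> i = 1 \<and> \<theta> = \<beta>" using assms by blast
  have \<pi>: "\<pi> > 0" using assms stationary_pos by blast
  have lln: "tendsto_prob walk (\<lambda>n xs. visits xs i / n) \<pi>"
    using visits_lln assms unfolding \<pi>0_def \<pi>1_def by auto
  have "tendsto_prob walk (\<lambda>n xs. (deviation \<theta> xs i / n + \<theta> * (visits xs i / n)) / (visits xs i / n))
      ((0 + \<theta> * \<pi>) / \<pi>)"
    using \<pi> by (intro tendsto_prob_divide tendsto_prob_add tendsto_prob_mult tendsto_prob_const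
        tendsto_const deviation_negligible[OF \<theta>] lln) auto
  then have "tendsto_prob walk (\<lambda>n xs. ratio xs i) ((0 + \<theta> * \<pi>) / \<pi>)"
  proof (rule tendsto_prob_cong_support)
    fix n :: nat and xs assume "n > 0"
    then show "(deviation \<theta> xs i / n + \<theta> * (visits xs i / n)) / (visits xs i / n) = ratio xs i"
      by (simp add: ratio_def deviation_def add_divide_distrib[symmetric])
  qed
  then show "tendsto_prob walk (\<lambda>n xs. ratio xs i) \<theta>" using \<pi> by simp
  have "(\<lambda>n. sqrt (Suc n) / sqrt n) \<longlonglongrightarrow> 1" by real_asymp
  then have "tendsto_prob walk (\<lambda>n xs. sqrt (Suc n) / sqrt n / (visits xs i / n) + - (1 / \<pi>)) (1 / \<pi> + - (1 / \<pi>))"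
    using \<pi> by (intro tendsto_prob_divide tendsto_prob_add tendsto_prob_const tendsto_const lln) auto
  then have "tendsto_prob walk (\<lambda>n xs. sqrt (Suc n) / sqrt n / (visits xs i / n) + - (1 / \<pi>)) 0" by simp
  from tight_prob_mult_null[OF tight_deviation[OF \<theta>] this]
  show "tendsto_prob walk (\<lambda>n xs. sqrt (Suc n) * (ratio xs i - \<theta>) - deviation \<theta> xs i / sqrt n / \<pi>) 0"
  proof (rule tendsto_prob_cong)
    have "(\<lambda>n. measure_pmf.prob (walk n) {xs. visits xs i / n \<in> {0<..}}) \<longlonglongrightarrow> 1"
      using \<pi> by (intro tendsto_prob_open[OF lln]) auto
    then show "(\<lambda>n. measure_pmf.prob (walk n) {xs.
        deviation \<theta> xs i / sqrt n * (sqrt (Suc n) / sqrt n / (visits xs i / n) + - (1 / \<pi>)) =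
        sqrt (Suc n) * (ratio xs i - \<theta>) - deviation \<theta> xs i / sqrt n / \<pi>}) \<longlonglongrightarrow> 1"
    proof (rule prob_tendsto_1_mono, safe)
      fix n xs assume "visits xs i / real n > 0"
      then have v: "visits xs i \<noteq> 0" "n > 0" by (auto simp: zero_less_divide_iff)
      then have e1: "ratio xs i - \<theta> = deviation \<theta> xs i / visits xs i"
        by (simp add: ratio_def deviation_def field_simps)
      have e2: "deviation \<theta> xs i / sqrt n * (sqrt (Suc n) / sqrt n / (visits xs i / n)) =
          sqrt (Suc n) * (deviation \<theta> xs i / visits xs i)"
      proof -
        have cancel: "x / r * (y / r / (z / r\<^sup>2)) = y * (x / z)" if "r > 0" for x y z r :: real
          using that by (simp add: power2_eq_square)
        show ?thesis using cancel[of "sqrt n"] v(2) by simp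
      qed
      show "deviation \<theta> xs i / sqrt n * (sqrt (Suc n) / sqrt n / (visits xs i / n) + - (1 / \<pi>)) =
        sqrt (Suc n) * (ratio xs i - \<theta>) - deviation \<theta> xs i / sqrt n / \<pi>"
        unfolding distrib_left e1 e2 by simp
    qed
  qed
qed

lemma p_hat_consistent: "tendsto_prob walk (\<lambda>n. p_hat) (\<pi>1 \<alpha> \<beta>)"
proof -
  have "tendsto_prob walk (\<lambda>n xs. ratio xs 0 / (1 + ((- 1) * ratio xs 1 + ratio xs 0))) (\<alpha> / (1 + ((- 1) * \<beta> + \<alpha>)))"
    using \<alpha> \<beta> by (intro tendsto_prob_divide tendsto_prob_add tendsto_prob_mult tendsto_prob_const
        tendsto_const ratio_error(1)) auto
  then show ?thesis by (simp add: p_hat_def[abs_def] \<pi>1_def algebra_simps)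
qed

text \<open>The derivative of (\<alpha>, \<beta>) -> (c\<alpha> + d\<beta>, \<pi>1), applied to the
  leading terms deviation / \<pi> of the two ratio errors.\<close>

definition linear_part :: "real \<Rightarrow> real \<Rightarrow> real \<times> real \<Rightarrow> real \<times> real" where
  "linear_part c d z = (c * (fst z / (\<pi>0 \<alpha> \<beta>)) + d * (snd z / (\<pi>1 \<alpha> \<beta>)),
     ((1 - \<beta>) * (fst z / (\<pi>0 \<alpha> \<beta>)) + \<alpha> * (snd z / (\<pi>1 \<alpha> \<beta>))) * (\<rho> \<alpha> \<beta>))"

lemma bounded_linear_linear_part: "bounded_linear (linear_part c d)"
  unfolding linear_part_def[abs_def]
  by (intro bounded_linear_Pair bounded_linear_add bounded_linear_const_mult bounded_linear_mult_const
      bounded_linear_compose[OF bounded_linear_divide bounded_linear_fst]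
      bounded_linear_compose[OF bounded_linear_divide bounded_linear_snd])

text \<open>The first coordinate is linear in the ratios. In the second the error factors exactly
  into a linear form in the ratio errors and a random factor tending to \<rho>, so no Taylor
  remainder has to be estimated.\<close>

lemma linearization:
  "tendsto_prob walk (\<lambda>n xs. scaled_error \<alpha> \<beta> c d n xs -
     linear_part c d (deviation \<alpha> xs 0 / sqrt n, deviation \<beta> xs 1 / sqrt n)) 0"
proof -
  define A where "A n xs = sqrt (Suc n) * (ratio xs 0 - \<alpha>)" for n xs
  define B where "B n xs = sqrt (Suc n) * (ratio xs 1 - \<beta>)" for n xs
  define LA where "LA n xs = deviation \<alpha> xs 0 / sqrt (real n) / (\<pi>0 \<alpha> \<beta>)" for n xs
  define LB where "LB n xs = deviation \<beta> xs 1 / sqrt (real n) / (\<pi>1 \<alpha> \<beta>)" for n xs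
  have A: "tendsto_prob walk (\<lambda>n xs. A n xs - LA n xs) 0" and B: "tendsto_prob walk (\<lambda>n xs. B n xs - LB n xs) 0"
    unfolding A_def B_def LA_def LB_def by (intro ratio_error(2); simp)+
  have comb: "tendsto_prob walk (\<lambda>n xs. c * (A n xs - LA n xs) + d * (B n xs - LB n xs)) 0" for c d
  proof -
    have "tendsto_prob walk (\<lambda>n xs. c * (A n xs - LA n xs) + d * (B n xs - LB n xs)) (c * 0 + d * 0)"
      by (intro tendsto_prob_add tendsto_prob_mult tendsto_prob_const tendsto_const A B)
    then show ?thesis by simp
  qed
  define q where "q xs = 1 + ((- 1) * ratio xs 1 + ratio xs 0)" for xs
  define r where "r xs = 1 / (q xs * (1 - \<beta> + \<alpha>))" for xs
  have pos: "1 - \<beta> + \<alpha> > 0" using \<alpha> \<beta> by simp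
  have q: "tendsto_prob walk (\<lambda>n. q) (1 + ((- 1) * \<beta> + \<alpha>))"
    unfolding q_def[abs_def] by (intro tendsto_prob_add tendsto_prob_mult tendsto_prob_const
        tendsto_const ratio_error(1)) auto
  have "tendsto_prob walk (\<lambda>n. r) (1 / ((1 + ((- 1) * \<beta> + \<alpha>)) * (1 - \<beta> + \<alpha>)))"
    unfolding r_def[abs_def] using pos
    by (intro tendsto_prob_divide tendsto_prob_mult tendsto_prob_const tendsto_const q) auto
  also have "1 / ((1 + ((- 1) * \<beta> + \<alpha>)) * (1 - \<beta> + \<alpha>)) = (\<rho> \<alpha> \<beta>)"
    by (simp add: \<rho>_def power2_eq_square algebra_simps)
  finally have r: "tendsto_prob walk (\<lambda>n. r) (\<rho> \<alpha> \<beta>)" .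
  define G where "G n xs = (1 - \<beta>) * LA n xs + \<alpha> * LB n xs" for n xs
  have "bounded_linear (\<lambda>z::real \<times> real. (1 - \<beta>) * (fst z / (\<pi>0 \<alpha> \<beta>)) + \<alpha> * (snd z / (\<pi>1 \<alpha> \<beta>)))"
    by (intro bounded_linear_add bounded_linear_const_mult
        bounded_linear_compose[OF bounded_linear_divide bounded_linear_fst]
        bounded_linear_compose[OF bounded_linear_divide bounded_linear_snd])
  from tight_prob_bounded_linear[OF tight_deviations this]
  have tight: "tight_prob walk G" by (simp add: G_def[abs_def] LA_def LB_def)
  have "tendsto_prob walk (\<lambda>n xs. r xs + - (\<rho> \<alpha> \<beta>)) ((\<rho> \<alpha> \<beta>) + - (\<rho> \<alpha> \<beta>))"
    by (intro tendsto_prob_add tendsto_prob_const tendsto_const r)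
  then have "tendsto_prob walk (\<lambda>n xs. r xs + - (\<rho> \<alpha> \<beta>)) 0" by simp
  from tight_prob_mult_null[OF tight this]
  have "tendsto_prob walk (\<lambda>n xs. G n xs * (r xs + - (\<rho> \<alpha> \<beta>)) +
      ((1 - \<beta>) * (A n xs - LA n xs) + \<alpha> * (B n xs - LB n xs)) * r xs) (0 + 0 * (\<rho> \<alpha> \<beta>))"
    by (intro tendsto_prob_add tendsto_prob_mult comb r)
  then have "tendsto_prob walk (\<lambda>n xs. sqrt (Suc n) * (p_hat xs - (\<pi>1 \<alpha> \<beta>)) - G n xs * (\<rho> \<alpha> \<beta>)) (0 + 0 * (\<rho> \<alpha> \<beta>))"
  proof (rule tendsto_prob_cong)
    have "(\<lambda>n. measure_pmf.prob (walk n) {xs. q xs \<in> {0<..}}) \<longlonglongrightarrow> 1"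
      using pos by (intro tendsto_prob_open[OF q]) auto
    then show "(\<lambda>n. measure_pmf.prob (walk n) {xs. G n xs * (r xs + - (\<rho> \<alpha> \<beta>)) +
      ((1 - \<beta>) * (A n xs - LA n xs) + \<alpha> * (B n xs - LB n xs)) * r xs =
      sqrt (Suc n) * (p_hat xs - (\<pi>1 \<alpha> \<beta>)) - G n xs * (\<rho> \<alpha> \<beta>)}) \<longlonglongrightarrow> 1"
    proof (rule prob_tendsto_1_mono, safe)
      fix n xs assume "q xs > 0"
      have "p_hat xs = ratio xs 0 / q xs" by (simp add: p_hat_def q_def algebra_simps)
      \<comment> \<open>Difference of two fractions: \<alpha> times the ratio of state 0 cancels
        from the numerator, which leaves an expression linear in the errors.\<close>
      then have error: "p_hat xs - (\<pi>1 \<alpha> \<beta>) = ((1 - \<beta>) * (ratio xs 0 - \<alpha>) + \<alpha> * (ratio xs 1 - \<beta>)) * r xs"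
        using \<open>q xs > 0\<close> pos unfolding \<pi>1_def r_def
        by (simp add: diff_frac_eq) (simp add: q_def algebra_simps)
      have "sqrt (Suc n) * (p_hat xs - (\<pi>1 \<alpha> \<beta>)) = ((1 - \<beta>) * A n xs + \<alpha> * B n xs) * r xs"
        unfolding error A_def B_def by (simp add: algebra_simps)
      then show "G n xs * (r xs + - (\<rho> \<alpha> \<beta>)) +
        ((1 - \<beta>) * (A n xs - LA n xs) + \<alpha> * (B n xs - LB n xs)) * r xs =
        sqrt (Suc n) * (p_hat xs - (\<pi>1 \<alpha> \<beta>)) - G n xs * (\<rho> \<alpha> \<beta>)"
        by (simp add: G_def algebra_simps)
    qed
  qed
  from tendsto_prob_Pair[OF comb[of c d] this]
  show ?thesis
    by (simp add: zero_prod_def scaled_error_def linear_part_def A_def B_def LA_def LB_def G_def algebra_simps)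
qed

text \<open>\<open>v\<alpha>\<close> and \<open>v\<beta>\<close> are the asymptotic variances of the
  two ratios, which are asymptotically uncorrelated. The entries are those of J
  diag(\<open>v\<alpha>\<close>, \<open>v\<beta>\<close>) J^T, where J has rows (c, d) and \<rho> (1
  - \<beta>, \<alpha>).\<close>

lemma asymptotic_normality:
  fixes c d :: real and f :: "real \<times> real \<Rightarrow> real"
  defines "v\<alpha> \<equiv> \<alpha> * (1 - \<alpha>) / (\<pi>0 \<alpha> \<beta>)" and "v\<beta> \<equiv> \<beta> * (1 - \<beta>) / (\<pi>1 \<alpha> \<beta>)"
  assumes s11: "s11 = c\<^sup>2 * v\<alpha> + d\<^sup>2 * v\<beta>"
    and s12: "s12 = (\<rho> \<alpha> \<beta>) * (c * (1 - \<beta>) * v\<alpha> + d * \<alpha> * v\<beta>)"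
    and s22: "s22 = (\<rho> \<alpha> \<beta>)\<^sup>2 * ((1 - \<beta>)\<^sup>2 * v\<alpha> + \<alpha>\<^sup>2 * v\<beta>)"
    and pd: "s11 > 0" "s11 * s22 - s12\<^sup>2 > 0"
    and f: "continuous_on UNIV f" "bounded (range f)"
  shows "(\<lambda>n. measure_pmf.expectation (walk n) (\<lambda>xs. f (scaled_error \<alpha> \<beta> c d n xs)))
    \<longlonglongrightarrow> (\<integral>z. f z \<partial>normal2 s11 s12 s22)"
proof (rule weak_convergence_from_characteristic_function[OF prob_space_normal2[OF pd] _ _ _ f])
  show "sets (normal2 s11 s12 s22) = sets borel" by (simp add: normal2_def)
  have "tight_prob walk (\<lambda>n xs. linear_part c d (deviation \<alpha> xs 0 / sqrt n, deviation \<beta> xs 1 / sqrt n))"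
    by (rule tight_prob_bounded_linear[OF tight_deviations bounded_linear_linear_part])
  then have "tight_prob walk (scaled_error \<alpha> \<beta> c d)"
    using linearization by (rule tight_prob_add_null)
  then show "\<exists>K. \<forall>\<^sub>F n in sequentially. measure_pmf.prob (walk n) {x. norm (scaled_error \<alpha> \<beta> c d n x) > K} < e"
    if "e > 0" for e using that unfolding tight_prob_def by blast
  fix w :: "real \<times> real"
  \<comment> \<open>The pair (\<open>v\<close>, \<open>u\<close>) is the adjoint of
    \<open>linear_part\<close> applied to \<open>w\<close>, so the limit is read off from the joint
    characteristic function of the deviations.\<close>
  define v where "v = (fst w * c + snd w * (\<rho> \<alpha> \<beta>) * (1 - \<beta>)) / (\<pi>0 \<alpha> \<beta>)"
  define u where "u = (fst w * d + snd w * (\<rho> \<alpha> \<beta>) * \<alpha>) / (\<pi>1 \<alpha> \<beta>)"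
  have inner: "w \<bullet> linear_part c d (x, y) = v * x + u * y" for x y
    by (simp add: inner_prod_def linear_part_def v_def u_def add_divide_distrib diff_divide_distrib algebra_simps)
  have "v\<^sup>2 * (\<alpha> * (1 - \<alpha>)) * (\<pi>0 \<alpha> \<beta>) = (fst w * c + snd w * (\<rho> \<alpha> \<beta>) * (1 - \<beta>))\<^sup>2 * v\<alpha>"
    "u\<^sup>2 * (\<beta> * (1 - \<beta>)) * (\<pi>1 \<alpha> \<beta>) = (fst w * d + snd w * (\<rho> \<alpha> \<beta>) * \<alpha>)\<^sup>2 * v\<beta>"
    using stationary_pos by (simp_all add: v_def u_def v\<alpha>_def v\<beta>_def power_divide power2_eq_square)
  then have "v\<^sup>2 * (\<alpha> * (1 - \<alpha>)) * (\<pi>0 \<alpha> \<beta>) + u\<^sup>2 * (\<beta> * (1 - \<beta>)) * (\<pi>1 \<alpha> \<beta>)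
      = s11 * (fst w)\<^sup>2 + 2 * s12 * fst w * snd w + s22 * (snd w)\<^sup>2"
    unfolding s11 s12 s22 by (simp add: power2_eq_square algebra_simps)
  then have "(\<integral>z. cis (w \<bullet> z) \<partial>normal2 s11 s12 s22) =
      exp (- (v\<^sup>2 * (\<alpha> * (1 - \<alpha>)) * (\<pi>0 \<alpha> \<beta>) + u\<^sup>2 * (\<beta> * (1 - \<beta>)) * (\<pi>1 \<alpha> \<beta>)) / 2)"
    by (simp only: char_normal2[OF pd])
  moreover have "(\<lambda>n. measure_pmf.expectation (walk n)
      (\<lambda>xs. cis (w \<bullet> linear_part c d (deviation \<alpha> xs 0 / sqrt n, deviation \<beta> xs 1 / sqrt n))))
    \<longlonglongrightarrow> exp (- (v\<^sup>2 * (\<alpha> * (1 - \<alpha>)) * (\<pi>0 \<alpha> \<beta>) + u\<^sup>2 * (\<beta> * (1 - \<beta>)) * (\<pi>1 \<alpha> \<beta>)) / 2)"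
    unfolding inner \<pi>0_def \<pi>1_def by (rule deviation_characteristic_function)
  ultimately have "(\<lambda>n. measure_pmf.expectation (walk n)
      (\<lambda>xs. cis (w \<bullet> linear_part c d (deviation \<alpha> xs 0 / sqrt n, deviation \<beta> xs 1 / sqrt n))))
    \<longlonglongrightarrow> (\<integral>z. cis (w \<bullet> z) \<partial>normal2 s11 s12 s22)" by (simp only:)
  then show "(\<lambda>n. measure_pmf.expectation (walk n) (\<lambda>xs. cis (w \<bullet> scaled_error \<alpha> \<beta> c d n xs)))
      \<longlonglongrightarrow> (\<integral>z. cis (w \<bullet> z) \<partial>normal2 s11 s12 s22)"
    by (rule characteristic_function_slutsky[OF linearization])
qed

end

section \<open>The maximum likelihood estimator\<close>

lemma trans_prob_complement:
  assumes "p \<noteq> 0" "p \<noteq> 1" "i \<in> {0, 1}"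
  shows "trans_prob a p i 0 = 1 - trans_prob a p i 1"
proof -
  have "1 - p \<noteq> 0" using assms(2) by simp
  with assms show ?thesis by (auto simp: trans_prob_def diff_divide_eq_iff divide_simps) (auto simp: algebra_simps)
qed

text \<open>Each row of the transition matrix sums to 1. Differentiability is established first,
  since \<open>deriv\<close> is meaningful only then.\<close>

lemma trans_prob_derivs:
  assumes "0 < p" "p < 1" "p \<noteq> 1 / 2" "i \<in> {0, 1}"
  shows "deriv (\<lambda>a. trans_prob a p i 0) a = - deriv (\<lambda>a. trans_prob a p i 1) a"
    and "deriv (\<lambda>p. trans_prob a p i 0) p = - deriv (\<lambda>p. trans_prob a p i 1) p"
proof -
  have "(\<lambda>a. trans_prob a p i 1) field_differentiable at a"
    using assms unfolding trans_prob_def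
    by (cases "p < 1 / 2"; cases "i = 0") (simp_all add: derivative_intros)
  then obtain D where D: "((\<lambda>a. trans_prob a p i 1) has_field_derivative D) (at a)"
    unfolding field_differentiable_def by blast
  have "((\<lambda>a. 1 - trans_prob a p i 1) has_field_derivative 0 - D) (at a)"
    by (intro derivative_intros D)
  moreover have "(\<lambda>a. trans_prob a p i 0) = (\<lambda>a. 1 - trans_prob a p i 1)"
    using assms by (intro ext trans_prob_complement) auto
  ultimately show "deriv (\<lambda>a. trans_prob a p i 0) a = - deriv (\<lambda>a. trans_prob a p i 1) a"
    using D by (simp add: DERIV_imp_deriv del: One_nat_def)
next
  have "\<exists>D. ((\<lambda>p. trans_prob a p i 1) has_field_derivative D) (at p)"
  proof (cases "p < 1 / 2")
    case True
    have "(\<lambda>p. if i = 0 then p * (1 - a) / (1 - p) else a) field_differentiable at p"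
      using assms by (cases "i = 0") (simp_all add: derivative_intros)
    \<comment> \<open>The formula changes at 1/2, so the rational expression represents the
      transition probability only in a neighbourhood of p.\<close>
    moreover have ev: "\<forall>\<^sub>F q in nhds p. trans_prob a q i 1 = (if i = 0 then q * (1 - a) / (1 - q) else a)"
      using eventually_nhds_in_open[of "{..<1 / 2}" p] True assms(4)
      by (auto elim!: eventually_mono simp: trans_prob_def)
    ultimately show ?thesis
      unfolding field_differentiable_def DERIV_cong_ev[OF refl ev refl] by blast
  next
    case False
    with assms(3) have "p \<in> {1 / 2<..}" by simp
    have "(\<lambda>p. if i = 0 then 1 - a else (a * (1 - p) + 2 * p - 1) / p) field_differentiable at p"
      using assms by (cases "i = 0") (simp_all add: derivative_intros)
    moreover have ev: "\<forall>\<^sub>F q in nhds p. trans_prob a q i 1 = (if i = 0 then 1 - a else (a * (1 - q) + 2 * q - 1) / q)"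
      using eventually_nhds_in_open[OF _ \<open>p \<in> {1 / 2<..}\<close>] assms(4)
      by (auto elim!: eventually_mono simp: trans_prob_def)
    ultimately show ?thesis
      unfolding field_differentiable_def DERIV_cong_ev[OF refl ev refl] by blast
  qed
  then obtain D where D: "((\<lambda>p. trans_prob a p i 1) has_field_derivative D) (at p)" by blast
  have "((\<lambda>p. 1 - trans_prob a p i 1) has_field_derivative 0 - D) (at p)"
    by (intro derivative_intros D)
  moreover have ev: "\<forall>\<^sub>F q in nhds p. trans_prob a q i 0 = 1 - trans_prob a q i 1"
  proof (rule eventually_mono)
    show "\<forall>\<^sub>F q in nhds p. q \<in> {0<..<1}"
      using assms by (intro eventually_nhds_in_open) auto
    show "trans_prob a q i 0 = 1 - trans_prob a q i 1" if "q \<in> {0<..<1}" for q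
      using that assms by (intro trans_prob_complement) auto
  qed
  ultimately have "((\<lambda>p. trans_prob a p i 0) has_field_derivative 0 - D) (at p)"
    unfolding DERIV_cong_ev[OF refl ev refl] by blast
  then show "deriv (\<lambda>p. trans_prob a p i 0) p = - deriv (\<lambda>p. trans_prob a p i 1) p"
    using D by (simp add: DERIV_imp_deriv del: One_nat_def)
qed

lemma ratio_pos_less_1D:
  assumes "0 < ratio xs i" "ratio xs i < 1"
  shows "trans_count xs i 0 > 0" "trans_count xs i 1 > 0"
  using assms unfolding ratio_def visits_def
  by (auto simp: zero_less_divide_iff divide_less_eq split: if_splits intro!: Nat.gr0I)

text \<open>At the estimator every quotient of count and transition probability in row i equals the
  number of visits to i, so the equations reduce to the derivatives of each row summing to zero.\<close>
lemma likelihood_equationsI: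
  assumes ratio: "0 < ratio xs 0" "ratio xs 0 < 1" "0 < ratio xs 1" "ratio xs 1 < 1"
    and p: "0 < p" "p < 1" "p \<noteq> 1 / 2"
    and eq: "trans_prob a p 0 1 = ratio xs 0" "trans_prob a p 1 1 = ratio xs 1"
  shows "likelihood_equations xs (a, p)"
proof -
  have counts: "real (trans_count xs i 0) / trans_prob a p i 0 = visits xs i"
      "real (trans_count xs i 1) / trans_prob a p i 1 = visits xs i" if "i \<in> {0, 1}" for i
  proof -
    have t: "trans_prob a p i 1 = ratio xs i" "trans_prob a p i 0 = 1 - ratio xs i"
      using that eq trans_prob_complement[of p i a] p by auto
    have pos: "trans_count xs i 0 > 0" "trans_count xs i 1 > 0"
      using that ratio ratio_pos_less_1D[of xs i] by auto
    have "1 - ratio xs i = real (trans_count xs i 0) / visits xs i"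
      using pos by (simp add: ratio_def visits_def field_simps)
    then show "real (trans_count xs i 0) / trans_prob a p i 0 = visits xs i"
      using pos unfolding t by simp
    show "real (trans_count xs i 1) / trans_prob a p i 1 = visits xs i"
      using pos unfolding t by (simp add: ratio_def)
  qed
  have row: "(\<Sum>j\<in>{0, 1}. real (trans_count xs i j) / trans_prob a p i j * h i j) = 0"
    if "i \<in> {0, 1}" "h i 0 = - h i 1" for i and h :: "nat \<Rightarrow> nat \<Rightarrow> real"
  proof -
    have "(\<Sum>j\<in>{0, 1}. real (trans_count xs i j) / trans_prob a p i j * h i j)
        = real (trans_count xs i 0) / trans_prob a p i 0 * h i 0
          + real (trans_count xs i 1) / trans_prob a p i 1 * h i 1" by simp
    also have "\<dots> = 0" unfolding counts[OF that(1)] that(2) by simp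
    finally show ?thesis .
  qed
  show ?thesis
    unfolding likelihood_equations_def fst_conv snd_conv
    by (intro conjI sum.neutral ballI row trans_prob_derivs p) simp_all
qed

text \<open>The chain is parametrised by its two free transition probabilities, whose maximum likelihood
  estimates are the empirical ratios; p is the stationary probability of state 1, while a is a
  transition probability of state 1 or of state 0, according to the half of the parameter space.\<close>
definition mle :: "bool \<Rightarrow> nat list \<Rightarrow> real \<times> real" where
  "mle low xs = (if low then ratio xs 1 else 1 - ratio xs 0, p_hat xs)"

text \<open>The transition probabilities at the estimate are exactly the ratios, in either half of
  the parameter space.\<close>

lemma mle_likelihood_equations:
  assumes ratio: "0 < ratio xs 0" "ratio xs 0 < 1" "0 < ratio xs 1" "ratio xs 1 < 1"
    and p: "if low then p_hat xs < 1 / 2 else p_hat xs > 1 / 2"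
  shows "likelihood_equations xs (mle low xs)"
proof -
  define q where "q = 1 - ratio xs 1 + ratio xs 0"
  have q: "q > 0" "p_hat xs = ratio xs 0 / q" "1 - p_hat xs = (1 - ratio xs 1) / q"
  proof -
    show "q > 0" using ratio by (simp add: q_def)
    show "p_hat xs = ratio xs 0 / q" by (simp add: p_hat_def q_def)
    then have "1 - p_hat xs = (q - ratio xs 0) / q" using \<open>q > 0\<close> by (simp add: diff_divide_distrib)
    then show "1 - p_hat xs = (1 - ratio xs 1) / q" by (simp add: q_def)
  qed
  have ph: "0 < p_hat xs" unfolding q(2) using q(1) ratio by simp
  have ph': "0 < 1 - p_hat xs" unfolding q(3) using q(1) ratio by simp
  \<comment> \<open>Both identities are the stationary balance p_hat (1 - ratio_1) = (1 - p_hat)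
    ratio_0, solved for one ratio at a time.\<close>
  have "p_hat xs * (1 - ratio xs 1) / (1 - p_hat xs) = ratio xs 0"
    "(1 - p_hat xs) * ratio xs 0 / p_hat xs = 1 - ratio xs 1"
    unfolding q(3) unfolding q(2) using q(1) ratio by simp_all
  moreover have "((1 - ratio xs 0) * (1 - p_hat xs) + 2 * p_hat xs - 1) / p_hat xs
      = 1 - (1 - p_hat xs) * ratio xs 0 / p_hat xs"
    using ph by (simp add: field_simps)
  ultimately show ?thesis
    unfolding mle_def using p ph ph' by (intro likelihood_equationsI ratio) (auto simp: trans_prob_def split: if_splits)
qed

section \<open>Identification of the limiting covariance\<close>

lemma stationary_trans_prob:
  assumes "0 < a" "a < 1" "0 < p" "p < 1"
  defines "\<alpha> \<equiv> trans_prob a p 0 1" and "\<beta> \<equiv> trans_prob a p 1 1"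
  shows "1 - \<beta> + \<alpha> = (if p < 1 / 2 then (1 - a) / (1 - p) else (1 - a) / p)"
    and "\<pi>1 \<alpha> \<beta> = p" and "\<pi>0 \<alpha> \<beta> = 1 - p"
proof -
  show 1: "1 - \<beta> + \<alpha> = (if p < 1 / 2 then (1 - a) / (1 - p) else (1 - a) / p)"
    using assms by (auto simp: \<alpha>_def \<beta>_def trans_prob_def field_simps)
  have \<alpha>: "\<alpha> = p * (1 - \<beta> + \<alpha>)"
    unfolding 1 using assms by (auto simp: \<alpha>_def trans_prob_def)
  have \<beta>: "1 - \<beta> = (1 - p) * (1 - \<beta> + \<alpha>)"
    unfolding 1 using assms by (auto simp: \<beta>_def trans_prob_def field_simps)
  have ne: "1 - \<beta> + \<alpha> \<noteq> 0" unfolding 1 using assms by auto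
  show "\<pi>1 \<alpha> \<beta> = p" unfolding \<pi>1_def nonzero_divide_eq_eq[OF ne] by (rule \<alpha>)
  show "\<pi>0 \<alpha> \<beta> = 1 - p" unfolding \<pi>0_def nonzero_divide_eq_eq[OF ne] by (rule \<beta>)
qed

text \<open>The determinant is a (1 - p) (1 - 2p + ap) below 1/2, and the mirror image under p -> 1
  - p above; on each side the last factor is a sum of two positive terms.\<close>

lemma Sigma_inv_pos_def:
  assumes "0 < a" "a < 1" "0 < p" "p < 1" "p \<noteq> 1 / 2" "Sigma_inv a p = (s11, s12, s22)"
  shows "s11 > 0" "s11 * s22 - s12\<^sup>2 > 0"
proof -
  show "s11 > 0" using assms by (auto simp: Sigma_inv_def split: if_splits)
  show "s11 * s22 - s12\<^sup>2 > 0"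
  proof (cases "p < 1 / 2")
    case True
    have "s11 * s22 - s12\<^sup>2 = a * (1 - p) * (1 - 2 * p + a * p)"
    proof -
      have cancel: "a * x / p * (p * y * k / x) = a * y * k" if "x \<noteq> 0" for x y k :: real
        using that assms(3) by (simp add: field_simps)
      have S: "s11 = a * (1 - a) / p" "s12 = a * (1 - p)" "s22 = p * (1 - p) * (a + 1 - 2 * p) / (1 - a)"
        using assms(6) True by (simp_all add: Sigma_inv_def)
      then have e: "s11 * s22 = a * (1 - p) * (a + 1 - 2 * p)"
        using cancel[of "1 - a" "1 - p"] assms(2) by simp
      show ?thesis unfolding e S(2) by (simp add: power2_eq_square algebra_simps)
    qed
    moreover have "1 - 2 * p + a * p > 0" using assms True by (intro add_pos_pos) auto
    ultimately show ?thesis using assms by simp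
  next
    case False
    have "s11 * s22 - s12\<^sup>2 = a * p * (2 * p - 1 + a * (1 - p))"
    proof -
      have cancel: "a * x / y * (p * y * k / x) = a * p * k" if "x \<noteq> 0" "y \<noteq> 0" for x y k :: real
        using that by (simp add: field_simps)
      have S: "s11 = a * (1 - a) / (1 - p)" "s12 = - a * p" "s22 = p * (1 - p) * (2 * p - 1 + a) / (1 - a)"
        using assms(6) False by (simp_all add: Sigma_inv_def)
      then have e: "s11 * s22 = a * p * (2 * p - 1 + a)"
        using cancel[of "1 - a" "1 - p"] assms(2,4) by simp
      show ?thesis unfolding e S(2) by (simp add: power2_eq_square algebra_simps)
    qed
    moreover have "2 * p - 1 + a * (1 - p) > 0" using assms False by (intro add_pos_pos) auto
    ultimately show ?thesis using assms by simp
  qed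
qed

text \<open>The constants \<open>c\<close> and \<open>d\<close> express a as \<beta> below 1/2 and
  as 1 - \<alpha> above, up to an additive constant. Substituting the complements 1 - a and 1 - p
  keeps the rational identities manageable.\<close>

lemma Sigma_inv_delta_method:
  assumes ap: "0 < a" "a < 1" "0 < p" "p < 1" "p \<noteq> 1 / 2"
    and S: "Sigma_inv a p = (s11, s12, s22)"
  defines "\<alpha> \<equiv> trans_prob a p 0 1" and "\<beta> \<equiv> trans_prob a p 1 1"
  defines "c \<equiv> if p < 1 / 2 then 0 else - 1" and "d \<equiv> if p < 1 / 2 then 1 else 0"
  shows "s11 = c\<^sup>2 * (\<alpha> * (1 - \<alpha>) / \<pi>0 \<alpha> \<beta>) + d\<^sup>2 * (\<beta> * (1 - \<beta>) / \<pi>1 \<alpha> \<beta>)"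
    and "s12 = \<rho> \<alpha> \<beta> * (c * (1 - \<beta>) * (\<alpha> * (1 - \<alpha>) / \<pi>0 \<alpha> \<beta>) + d * \<alpha> * (\<beta> * (1 - \<beta>) / \<pi>1 \<alpha> \<beta>))"
    and "s22 = (\<rho> \<alpha> \<beta>)\<^sup>2 * ((1 - \<beta>)\<^sup>2 * (\<alpha> * (1 - \<alpha>) / \<pi>0 \<alpha> \<beta>) + \<alpha>\<^sup>2 * (\<beta> * (1 - \<beta>) / \<pi>1 \<alpha> \<beta>))"
proof -
  note st = stationary_trans_prob[OF ap(1-4), folded \<alpha>_def \<beta>_def]
  define x y where "x = 1 - a" and "y = 1 - p"
  have xy: "a = 1 - x" "p = 1 - y" "x \<noteq> 0" "y \<noteq> 0" "p \<noteq> 0" using ap by (simp_all add: x_def y_def)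
  have "s11 = c\<^sup>2 * (\<alpha> * (1 - \<alpha>) / \<pi>0 \<alpha> \<beta>) + d\<^sup>2 * (\<beta> * (1 - \<beta>) / \<pi>1 \<alpha> \<beta>) \<and>
    s12 = \<rho> \<alpha> \<beta> * (c * (1 - \<beta>) * (\<alpha> * (1 - \<alpha>) / \<pi>0 \<alpha> \<beta>) + d * \<alpha> * (\<beta> * (1 - \<beta>) / \<pi>1 \<alpha> \<beta>)) \<and>
    s22 = (\<rho> \<alpha> \<beta>)\<^sup>2 * ((1 - \<beta>)\<^sup>2 * (\<alpha> * (1 - \<alpha>) / \<pi>0 \<alpha> \<beta>) + \<alpha>\<^sup>2 * (\<beta> * (1 - \<beta>) / \<pi>1 \<alpha> \<beta>))"
  proof (cases "p < 1 / 2")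
    case True
    have v: "\<alpha> = p * x / y" "\<beta> = a" "1 - \<beta> = x" "c = 0" "d = 1"
      using True by (simp_all add: \<alpha>_def \<beta>_def trans_prob_def x_def y_def c_def d_def)
    have \<rho>: "\<rho> \<alpha> \<beta> = y\<^sup>2 / x\<^sup>2" using True unfolding \<rho>_def st(1) by (simp add: x_def y_def power_divide)
    \<comment> \<open>\<open>t\<close> is the stationary joint probability of two consecutive
      zeros.\<close>
    define t where "t = y - p * x"
    have S': "s11 = a * x / p" "s12 = a * y" "s22 = p * y * (a * y + t) / x"
      using S True by (auto simp: Sigma_inv_def x_def y_def t_def algebra_simps)
    have w: "1 - \<alpha> = t / y" using xy by (simp add: v t_def field_simps)
    have k: "\<alpha> * (1 - \<alpha>) = p * x * t / y\<^sup>2" unfolding w unfolding v(1)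
      by (simp add: power2_eq_square)
    show ?thesis
      unfolding st(2,3) \<rho> y_def[symmetric] S' k v(3) unfolding v(1,2,4,5) using xy(3-5)
      by (simp add: field_simps power2_eq_square)
  next
    case False
    have v: "\<alpha> = x" "1 - \<alpha> = a" "1 - \<beta> = y * x / p" "c = - 1" "d = 0"
      using False xy(5) by (simp_all add: \<alpha>_def \<beta>_def trans_prob_def x_def y_def c_def d_def field_simps)
    \<comment> \<open>\<open>t\<close> is now the stationary joint probability of two consecutive
      ones.\<close>
    define t where "t = p - y * x"
    have w: "\<beta> = t / p" using v(3) xy(5) by (simp add: t_def field_simps)
    have \<rho>: "\<rho> \<alpha> \<beta> = p\<^sup>2 / x\<^sup>2" using False unfolding \<rho>_def st(1) by (simp add: x_def y_def power_divide)
    have S': "s11 = a * x / y" "s12 = - a * p" "s22 = p * y * (a * p + t) / x"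
      using S False by (auto simp: Sigma_inv_def x_def y_def t_def algebra_simps)
    show ?thesis
      unfolding st(2,3) \<rho> y_def[symmetric] S' v(2,3) unfolding w v(1,4,5) using xy(3-5)
      by (simp add: field_simps power2_eq_square)
  qed
  then show "s11 = c\<^sup>2 * (\<alpha> * (1 - \<alpha>) / \<pi>0 \<alpha> \<beta>) + d\<^sup>2 * (\<beta> * (1 - \<beta>) / \<pi>1 \<alpha> \<beta>)"
    "s12 = \<rho> \<alpha> \<beta> * (c * (1 - \<beta>) * (\<alpha> * (1 - \<alpha>) / \<pi>0 \<alpha> \<beta>) + d * \<alpha> * (\<beta> * (1 - \<beta>) / \<pi>1 \<alpha> \<beta>))"
    "s22 = (\<rho> \<alpha> \<beta>)\<^sup>2 * ((1 - \<beta>)\<^sup>2 * (\<alpha> * (1 - \<alpha>) / \<pi>0 \<alpha> \<beta>) + \<alpha>\<^sup>2 * (\<beta> * (1 - \<beta>) / \<pi>1 \<alpha> \<beta>))"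
    by blast+
qed

theorem theorem3:
  fixes \<Theta> :: "(real \<times> real) set"
  assumes "\<Theta> = {(a, p). 0 < a \<and> a < 1 \<and> 0 < p \<and> p < 1/2}
         \<or> \<Theta> = {(a, p). 0 < a \<and> a < 1 \<and> 1/2 < p \<and> p < 1}"
  shows "\<exists>est :: nat list \<Rightarrow> real \<times> real.
           \<forall>a p. (a, p) \<in> \<Theta> \<longrightarrow>
             (\<forall>(M :: 'w measure) X. copula_bernoulli_chain M X a p \<longrightarrow>
                (\<lambda>n. measure M {\<omega>\<in>space M. likelihood_equations (sample X n \<omega>) (est (sample X n \<omega>))})
                   \<longlonglongrightarrow> 1
              \<and> conv_in_prob M (\<lambda>n \<omega>. est (sample X n \<omega>)) (a, p)
              \<and> conv_in_distr M
                  (\<lambda>n \<omega>. sqrt (real (Suc n)) *\<^sub>R (est (sample X n \<omega>) - (a, p)))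
                  (case Sigma_inv a p of (s11, s12, s22) \<Rightarrow> normal2 s11 s12 s22))"
proof -
  \<comment> \<open>Only the half of the parameter space enters the estimator, so one estimator
    serves all parameters in \<Theta>.\<close>
  obtain low where low: "\<And>a p. (a, p) \<in> \<Theta> \<Longrightarrow>
      0 < a \<and> a < 1 \<and> 0 < p \<and> p < 1 \<and> (if low then p < 1 / 2 else 1 / 2 < p)"
    using assms
  proof
    assume "\<Theta> = {(a, p). 0 < a \<and> a < 1 \<and> 0 < p \<and> p < 1/2}"
    then show thesis by (intro that[of True]) auto
  next
    assume "\<Theta> = {(a, p). 0 < a \<and> a < 1 \<and> 1/2 < p \<and> p < 1}"
    then show thesis by (intro that[of False]) auto
  qed
  show ?thesis
  proof (intro exI[of _ "mle low"] allI impI)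
    fix a p and M :: "'w measure" and X
    assume "(a, p) \<in> \<Theta>" and chain: "copula_bernoulli_chain M X a p"
    from low[OF this(1)] have ap: "0 < a" "a < 1" "0 < p" "p < 1" "p \<noteq> 1 / 2"
      and half: "if low then p < 1 / 2 else 1 / 2 < p" and low: "low \<longleftrightarrow> p < 1 / 2" by (auto split: if_splits)
    define \<alpha> \<beta> where "\<alpha> = trans_prob a p 0 1" and "\<beta> = trans_prob a p 1 1"
    have \<alpha>: "0 < \<alpha>" "\<alpha> < 1" and \<beta>: "0 < \<beta>" "\<beta> < 1"
      using trans_prob_bounds[OF ap(1-4)] by (simp_all add: \<alpha>_def \<beta>_def)
    note \<pi> = stationary_trans_prob(2)[OF ap(1-4), folded \<alpha>_def \<beta>_def]
    let ?P = "path_pmf p \<alpha> \<beta>"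
    have prob: "measure M {\<omega>\<in>space M. Q (sample X n \<omega>)} = measure_pmf.prob (?P n) {xs. Q xs}" for Q n
      unfolding \<alpha>_def \<beta>_def by (rule prob_sample[OF chain ap(1-4)])
    have r0: "tendsto_prob ?P (\<lambda>n xs. ratio xs 0) \<alpha>" and r1: "tendsto_prob ?P (\<lambda>n xs. ratio xs 1) \<beta>"
      by (rule ratio_error(1)[OF \<alpha> \<beta>]; simp)+
    have ph: "tendsto_prob ?P (\<lambda>n. p_hat) p"
      using p_hat_consistent[OF \<alpha> \<beta>] by (simp only: \<pi>)
    have a: "a = (if low then \<beta> else 1 - \<alpha>)"
      using low half by (auto simp: \<alpha>_def \<beta>_def trans_prob_def)
    have likelihood: "(\<lambda>n. measure M {\<omega>\<in>space M. likelihood_equations (sample X n \<omega>) (mle low (sample X n \<omega>))})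
                   \<longlonglongrightarrow> 1"
      unfolding prob[where Q="\<lambda>xs. likelihood_equations xs (mle low xs)"]
    proof (rule prob_tendsto_1_mono)
      \<comment> \<open>An open set containing the true (\<alpha>, \<beta>, p) on which the estimate
        solves the equations: ratios strictly between 0 and 1, and p_hat strictly on the correct
        side of 1/2.\<close>
      let ?S = "{0<..<1} \<times> {0<..<1} \<times> (if low then {..<1 / 2} else {1 / 2<..}) :: (real \<times> real \<times> real) set"
      show "(\<lambda>n. measure_pmf.prob (?P n) {xs. (ratio xs 0, ratio xs 1, p_hat xs) \<in> ?S}) \<longlonglongrightarrow> 1"
        using \<alpha> \<beta> half
        by (intro tendsto_prob_open[OF tendsto_prob_Pair[OF r0 tendsto_prob_Pair[OF r1 ph]]] open_Times) auto
      show "{xs. (ratio xs 0, ratio xs 1, p_hat xs) \<in> ?S} \<subseteq> {xs. likelihood_equations xs (mle low xs)}" for n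
        by (auto intro!: mle_likelihood_equations split: if_splits)
    qed
    have "tendsto_prob ?P (\<lambda>n. mle low) (a, p)"
    proof (cases low)
      case True
      then show ?thesis using tendsto_prob_Pair[OF r1 ph] by (simp add: mle_def[abs_def] a)
    next
      case False
      have "tendsto_prob ?P (\<lambda>n xs. 1 + (- 1) * ratio xs 0) (1 + (- 1) * \<alpha>)"
        by (intro tendsto_prob_add tendsto_prob_mult tendsto_prob_const tendsto_const r0)
      from tendsto_prob_Pair[OF this ph] False show ?thesis by (simp add: mle_def[abs_def] a)
    qed
    then have consistent: "conv_in_prob M (\<lambda>n \<omega>. mle low (sample X n \<omega>)) (a, p)"
      unfolding conv_in_prob_def tendsto_prob_def prob[where Q="\<lambda>xs. dist (mle low xs) (a, p) > _"] .
    obtain s11 s12 s22 where S: "Sigma_inv a p = (s11, s12, s22)" by (cases "Sigma_inv a p")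
    note cov = Sigma_inv_delta_method[OF ap S, folded \<alpha>_def \<beta>_def]
    have scaled: "sqrt (real (Suc n)) *\<^sub>R (mle low xs - (a, p)) =
        scaled_error \<alpha> \<beta> (if p < 1 / 2 then 0 else - 1) (if p < 1 / 2 then 1 else 0) n xs" for n xs
      using low by (simp add: mle_def scaled_error_def a \<pi>)
    have "conv_in_distr M (\<lambda>n \<omega>. sqrt (real (Suc n)) *\<^sub>R (mle low (sample X n \<omega>) - (a, p))) (normal2 s11 s12 s22)"
      unfolding conv_in_distr_def
    proof (intro allI impI)
      fix f :: "real \<times> real \<Rightarrow> real"
      assume f: "continuous_on UNIV f \<and> bounded (range f)"
      have "(\<integral>\<omega>. f (sqrt (real (Suc n)) *\<^sub>R (mle low (sample X n \<omega>) - (a, p))) \<partial>M) =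
         measure_pmf.expectation (?P n) (\<lambda>xs. f (sqrt (real (Suc n)) *\<^sub>R (mle low xs - (a, p))))" for n
        unfolding \<alpha>_def \<beta>_def by (rule expectation_sample[OF chain ap(1-4)])
      then show "(\<lambda>n. \<integral>\<omega>. f (sqrt (real (Suc n)) *\<^sub>R (mle low (sample X n \<omega>) - (a, p))) \<partial>M)
          \<longlonglongrightarrow> (\<integral>z. f z \<partial>normal2 s11 s12 s22)"
        unfolding scaled
        using asymptotic_normality[OF \<alpha> \<beta> cov Sigma_inv_pos_def[OF ap S]] f by (simp only: )
    qed
    with likelihood consistent show "(\<lambda>n. measure M {\<omega>\<in>space M. likelihood_equations (sample X n \<omega>) (mle low (sample X n \<omega>))})
                   \<longlonglongrightarrow> 1
              \<and> conv_in_prob M (\<lambda>n \<omega>. mle low (sample X n \<omega>)) (a, p)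
              \<and> conv_in_distr M
                  (\<lambda>n \<omega>. sqrt (real (Suc n)) *\<^sub>R (mle low (sample X n \<omega>) - (a, p)))
                  (case Sigma_inv a p of (s11, s12, s22) \<Rightarrow> normal2 s11 s12 s22)"
      by (simp only: S prod.case)
  qed
qed

end
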